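(* Let $M\in\mathcal{A}$ and $P = \mathrm{New}(M)$. Then $P$ is in a unique way expressible as a convergent Minkowski sum of the generalized lattice polyhedra $$N(F_j) = \mathbb{R}_+^2 + \ell_j,\qquad j\ge1,$$ where $\ell_j$ is the line segment from the origin to the lattice point $(j,-1)$. That is, there is a unique sequence $(a_j)_{j\ge1}$ of non-negative integers such that $P = \sum_{j=1}^\infty a_j N(F_j)$, as a convergent sum.
   Context: $\mathbb{N} = \{0,1,2,\dots\}$, $\mathbb{R}_+^2$ is the closed positive quadrant of $\mathbb{R}^2$. Sums of subsets of $\mathbb{Z}^2$ or $\mathbb{R}^2$ are Minkowski sums, $A+B=\{u+v: u\in A, v\in B\}$; $aQ$ for $a\in\mathbb{N}$ denotes the Minkowski sum of $a$ copies of $Q$, the empty sum being $\mathbb{R}_+^2$ (for polyhedra). The set $\mathcal{A}$: A monoid submodule is a subset $L \subset \mathbb{Z}^2$ with $L + \mathbb{N}^2 \subset L$. It is co-artinian if it contains no infinite strictly descending chain for the componentwise order. It is integrally closed if $L = \operatorname{conv}(L)\cap\mathbb{Z}^2$ (convex hull in $\mathbb{R}^2$). Put $\mathrm{New}(L) = \operatorname{conv}(L)\subset\mathbb{R}^2$. $\mathcal{A}$ is the collection of all $L\subset\mathbb{Z}^2$ such that 1. $L$ is a monoid submodule; 2. $L$ is co-artinian; 3. $L$ is integrally closed; 4. $\mathbb{N}^2 \subset L$, every $(a,b)\in L$ has $a\ge 0$, and $(0,b)\in L$ implies $b \ge 0$; 5. $P=\mathrm{New}(L)$ contains no infinite ray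 $\{t(a,b) : t\ge 0\}$ with $b<0<a$; 6. $P$ has no infinite facet except the positive $y$-axis and (possibly) an infinite ray parallel to the $x$-axis; 7. every finite facet of $P$ is a line segment joining vertices $(c,d)$ and $(c+mk, d-m)$ for some positive integers $k,m$ and integers $d\le 0\le c$; i.e. it has outward normal $(-1,-k)$. $F_j = \mathbb{N}^2\cup\big((j,-1)+\mathbb{N}^2\big)\in\mathcal{A}$, and $N(F_j)=\mathrm{New}(F_j)$. Convergence: $\mathcal{A}$ has the subspace topology via the embedding $L \mapsto \chi_L=\sum_{\alpha\in L} x^\alpha$ into $\mathbb{Z}^{\mathbb{Z}^2}$ with the product topology, $\mathbb{Z}$ discrete. The set of Newton polyhedra $\{\mathrm{New}(L): L\in\mathcal{A}\}$ is identified with $\mathcal{A}$ through the bijection $L\mapsto\mathrm{New}(L)$ (with inverse $Q\mapsto Q\cap\mathbb{Z}^2$), and convergence of a Minkowski sum of such polyhedra means that the partial sums converge in the corresponding topology, i.e. each lattice point $\alpha\in\mathbb{Z}^2$ lies in all sufficiently late partial sums if it lies in the limit, and in none of the sufficiently late partial sums otherwise. *)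

theory Defs
  imports "HOL-Analysis.Analysis"
begin

definition lattice_emb :: "int \<times> int \<Rightarrow> real \<times> real" where
  "lattice_emb v = (real_of_int (fst v), real_of_int (snd v))"

text \<open>\<open>Q \<inter> \<int>\<^sup>2\<close>, as a set of integer pairs.\<close>
definition lattice_points :: "(real \<times> real) set \<Rightarrow> (int \<times> int) set" where
  "lattice_points Q = lattice_emb -` Q"

definition New :: "(int \<times> int) set \<Rightarrow> (real \<times> real) set" where
  "New L = convex hull (lattice_emb ` L)"

definition nat_quadrant :: "(int \<times> int) set" where
  "nat_quadrant = {0..} \<times> {0..}"

definition real_quadrant :: "(real \<times> real) set" where
  "real_quadrant = {0..} \<times> {0..}"

definition monoid_submodule :: "(int \<times> int) set \<Rightarrow> bool" where
  "monoid_submodule L \<longleftrightarrow> L + nat_quadrant \<subseteq> L"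

text \<open>The order on \<open>int \<times> int\<close> is the componentwise one of \<open>HOL-Library.Product_Order\<close>.\<close>
definition co_artinian :: "(int \<times> int) set \<Rightarrow> bool" where
  "co_artinian L \<longleftrightarrow> \<not> (\<exists>f :: nat \<Rightarrow> int \<times> int. (\<forall>n. f n \<in> L) \<and> (\<forall>n. f (Suc n) < f n))"

definition integrally_closed :: "(int \<times> int) set \<Rightarrow> bool" where
  "integrally_closed L \<longleftrightarrow> L = lattice_points (New L)"

definition calA :: "(int \<times> int) set set" where
  "calA = {L. monoid_submodule L \<and> co_artinian L \<and> integrally_closed L
     \<and> nat_quadrant \<subseteq> L \<and> (\<forall>a b. (a, b) \<in> L \<longrightarrow> 0 \<le> a) \<and> (\<forall>b. (0, b) \<in> L \<longrightarrow> 0 \<le> b)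
     \<and> (\<forall>a b :: real. b < 0 \<and> 0 < a \<longrightarrow> \<not> {t *\<^sub>R (a, b) | t. 0 \<le> t} \<subseteq> New L)
     \<and> (\<forall>S. S facet_of New L \<and> \<not> bounded S \<longrightarrow>
            S = {0} \<times> {0..} \<or> (\<exists>c d. S = {c..} \<times> {d}))
     \<and> (\<forall>S. S facet_of New L \<and> bounded S \<longrightarrow>
            (\<exists>c d k m :: int. 0 < k \<and> 0 < m \<and> d \<le> 0 \<and> 0 \<le> c \<and>
               S = closed_segment (lattice_emb (c, d)) (lattice_emb (c + m * k, d - m))))}"

definition F :: "nat \<Rightarrow> (int \<times> int) set" where
  "F j = nat_quadrant \<union> ({(int j, - 1)} + nat_quadrant)"

text \<open>
  The sum over the empty index set is the closed quadrant, which is the neutral element for the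
  polyhedra considered here, and not the neutral element \<open>{0}\<close> of Minkowski addition on arbitrary sets.
\<close>
definition poly_sum :: "('i \<Rightarrow> (real \<times> real) set) \<Rightarrow> 'i set \<Rightarrow> (real \<times> real) set" where
  "poly_sum Q I = (if I = {} then real_quadrant else (\<Sum>i\<in>I. Q i))"

definition poly_mult :: "nat \<Rightarrow> (real \<times> real) set \<Rightarrow> (real \<times> real) set" where
  "poly_mult a Q = poly_sum (\<lambda>_. Q) {..<a}"

text \<open>
  The subspace topology induced on \<open>calA\<close> by \<open>L \<mapsto> \<chi>\<^sub>L\<close> from the product topology on
  \<open>\<int>\<close>-valued functions, and its transport to the Newton polyhedra along the inverse
  \<open>Q \<mapsto> Q \<inter> \<int>\<^sup>2\<close> of \<open>New\<close>. The polyhedra \<open>New L\<close> with \<open>L \<in> calA\<close> are the points of the second space,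
  so a convergent sequence is eventually contained in this set.
\<close>
definition calA_topology :: "(int \<times> int) set topology" where
  "calA_topology = pullback_topology calA (\<lambda>L. indicator L :: int \<times> int \<Rightarrow> int)
     (product_topology (\<lambda>_. discrete_topology UNIV) UNIV)"

definition Newton_topology :: "(real \<times> real) set topology" where
  "Newton_topology = pullback_topology (New ` calA) lattice_points calA_topology"

definition converges_to_poly :: "(nat \<Rightarrow> (real \<times> real) set) \<Rightarrow> (real \<times> real) set \<Rightarrow> bool" where
  "converges_to_poly Q P \<longleftrightarrow>
     limitin Newton_topology (\<lambda>n. poly_sum Q {1..n}) P sequentially"

end

theory Submission
  imports Defs
begin

text \<open>
  The polyhedra are compared through their support values in the directions \<open>(1, k)\<close>, that is,
  through the minima of \<open>x + k y\<close> for \<open>k = 0, 1, 2, \<dots>\<close>. Minima are additive under Minkowski sums, and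
  the minimum over \<open>New (F j)\<close> is \<open>min 0 (j - k)\<close>. So the sum with multiplicities \<open>a\<close> has the support
  value \<open>h k = - (\<Sum>j<k. a j (k - j))\<close>. This formula can be inverted: \<open>a k\<close> is the negated second
  difference of \<open>h\<close> at \<open>k\<close> (\<open>support_value_second_difference\<close>). Uniqueness follows, because
  convergence determines the lattice points of the sum, each \<open>h k\<close> is attained at a lattice point
  (\<open>multiplicities_unique\<close>), and \<open>h\<close> determines \<open>a\<close>.

  For existence, let \<open>h k\<close> be the minimum of \<open>x + k y\<close> over \<open>M\<close>. As a minimum of functions that are
  affine in \<open>k\<close>, it is concave, so its negated second differences are natural numbers \<open>a k\<close>. It remains
  to see that \<open>M\<close> is cut out by the inequalities \<open>x + k y \<ge> h k\<close> alone
  (\<open>calA_mem_if_above_support\<close>). This is where the facet conditions enter. The lower boundary of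
  \<open>New M\<close> starts at the origin, and from each vertex that is not of minimal height it continues along a
  facet of negative slope. Such a facet is one of the allowed segments, so its slope is \<open>-1/k\<close> and it
  ends in a lattice point (\<open>next_edge\<close>). A lattice point above the boundary lies above one of these
  edges or to the upper right of the last vertex. The absence of falling rays guarantees that a lowest
  next edge exists: it bounds the part of \<open>M\<close> below a falling line (\<open>calA_below_sloped_line\<close>).

  The partial sums have to be points of the space in which the limit is taken. The sum of the terms up
  to \<open>n\<close> is the region \<open>x + k y \<ge> h k\<close> for the multiplicities cut off after \<open>n\<close>
  (\<open>poly_sum_eq_region\<close>): one inclusion is additivity of the support values, the other holds as
  the vertices of the region are sums of vertices of the summands. This region is a polyhedron whose facets can be
  listed (\<open>facet_of_region_cases\<close>), hence it comes from an element of \<open>calA\<close>. Finally, a lattice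
  point belongs to almost all of these regions exactly if it belongs to the region of the whole
  sequence (\<open>eventually_in_truncated_region\<close>).
\<close>

section \<open>Upward closed sets and Newton polyhedra\<close>

definition upward_closed :: "(real \<times> real) set \<Rightarrow> bool" where
  "upward_closed T \<longleftrightarrow> (\<forall>x y x' y'. (x, y) \<in> T \<and> x \<le> x' \<and> y \<le> y' \<longrightarrow> (x', y') \<in> T)"

lemma upward_closedD: "upward_closed T \<Longrightarrow> (x, y) \<in> T \<Longrightarrow> x \<le> x' \<Longrightarrow> y \<le> y' \<Longrightarrow> (x', y') \<in> T"
  unfolding upward_closed_def by blast

lemma upward_closed_real_quadrant: "upward_closed real_quadrant"
  by (auto simp: upward_closed_def real_quadrant_def)

lemma convex_real_quadrant: "convex real_quadrant"
  unfolding real_quadrant_def by (intro convex_Times) auto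

lemma plus_real_quadrant_subset_iff_upward_closed: "T + real_quadrant \<subseteq> T \<longleftrightarrow> upward_closed T"
proof
  assume *: "T + real_quadrant \<subseteq> T"
  show "upward_closed T"
    unfolding upward_closed_def
  proof (intro allI impI)
    fix x y x' y' assume h: "(x, y) \<in> T \<and> x \<le> x' \<and> y \<le> y'"
    then have "(x, y) + (x' - x, y' - y) \<in> T + real_quadrant"
      by (intro set_plus_intro) (auto simp: real_quadrant_def)
    then show "(x', y') \<in> T" using * by auto
  qed
next
  assume "upward_closed T"
  then show "T + real_quadrant \<subseteq> T"
    by (auto simp: set_plus_def real_quadrant_def elim!: upward_closedD)
qed

lemma plus_real_quadrant_if_upward_closed:
  assumes "upward_closed T"
  shows "T + real_quadrant = T"
proof
  show "T \<subseteq> T + real_quadrant"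
    using set_plus_intro[of _ T "0" real_quadrant] by (fastforce simp: real_quadrant_def zero_prod_def)
qed (use assms plus_real_quadrant_subset_iff_upward_closed in blast)

lemma upward_closed_plus:
  assumes "upward_closed A"
  shows "upward_closed (A + B)"
  unfolding upward_closed_def
proof (intro allI impI)
  fix x y x' y' assume h: "(x, y) \<in> A + B \<and> x \<le> x' \<and> y \<le> y'"
  then obtain p q r s where ab: "(p, q) \<in> A" "(r, s) \<in> B" "x = p + r" "y = q + s"
    by (auto simp: set_plus_def)
  then have "(x' - r, y' - s) \<in> A" using h upward_closedD[OF assms ab(1), of "x' - r" "y' - s"] by auto
  from set_plus_intro[OF this ab(2)] show "(x', y') \<in> A + B" by simp
qed

text \<open>
  The convex hull of a product is the product of the convex hulls, which leaves the one-dimensional fact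
  that the natural numbers span a half line.
\<close>
lemma New_nat_quadrant: "New nat_quadrant = real_quadrant"
proof -
  have half_line: "convex hull (real_of_int ` {0..}) = {0..}"
  proof
    show "convex hull (real_of_int ` {0..}) \<subseteq> {0..}"
      by (intro hull_minimal) auto
    show "{0..} \<subseteq> convex hull (real_of_int ` {0..})"
    proof
      fix x :: real assume "x \<in> {0..}"
      then have "x \<in> closed_segment (real_of_int 0) (real_of_int \<lceil>x\<rceil>)"
        by (simp add: closed_segment_eq_real_ivl)
      moreover have "closed_segment (real_of_int 0) (real_of_int \<lceil>x\<rceil>)
          \<subseteq> convex hull (real_of_int ` {0..})"
        using \<open>x \<in> {0..}\<close>
        by (intro closed_segment_subset convex_convex_hull hull_inc imageI) auto
      ultimately show "x \<in> convex hull (real_of_int ` {0..})" by blast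
    qed
  qed
  have "lattice_emb ` nat_quadrant = real_of_int ` {0..} \<times> real_of_int ` {0..}"
    by (force simp: lattice_emb_def nat_quadrant_def)
  then show ?thesis
    by (simp add: New_def convex_hull_Times half_line real_quadrant_def)
qed

lemma lattice_emb_set_plus: "lattice_emb ` (A + B) = lattice_emb ` A + lattice_emb ` B"
  by (force simp: set_plus_def lattice_emb_def image_def)

lemma New_plus: "New (A + B) = New A + New B"
  by (simp add: New_def lattice_emb_set_plus convex_hull_set_plus)

lemma convex_New: "convex (New L)"
  by (simp add: New_def)

lemma lattice_emb_in_New: "(a, b) \<in> L \<Longrightarrow> (real_of_int a, real_of_int b) \<in> New L"
  unfolding New_def by (rule hull_inc) (force simp: lattice_emb_def)

lemma upward_closed_New:
  assumes "monoid_submodule L"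
  shows "upward_closed (New L)"
proof -
  have "New (L + nat_quadrant) \<subseteq> New L"
    using assms unfolding monoid_submodule_def New_def by (intro hull_mono image_mono)
  then show ?thesis
    by (simp add: New_plus New_nat_quadrant plus_real_quadrant_subset_iff_upward_closed)
qed

text \<open>
  Both \<open>New\<close> and the lattice embedding turn Minkowski sums into Minkowski sums, and \<open>F j\<close> is the sum of the
  quadrant and a two-point set.
\<close>
lemma New_F: "New (F j) = real_quadrant + closed_segment (0, 0) (real j, - 1)"
proof -
  have "nat_quadrant + {(0, 0), (int j, - 1)} = nat_quadrant + 0 \<union> (nat_quadrant + {(int j, - 1)})"
    by (force simp: set_plus_def zero_prod_def set_zero)
  then have "F j = nat_quadrant + {(0, 0), (int j, - 1)}"
    by (simp add: F_def add.commute)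
  moreover have "New {(0, 0), (int j, - 1)} = closed_segment (0, 0) (real j, - 1)"
    by (simp add: New_def lattice_emb_def segment_convex_hull)
  ultimately show ?thesis
    by (simp add: New_plus New_nat_quadrant)
qed

lemma New_lower_bound:
  assumes "\<And>a b. (a, b) \<in> L \<Longrightarrow> C \<le> \<alpha> * real_of_int a + \<beta> * real_of_int b"
    and "(x, y) \<in> New L"
  shows "C \<le> \<alpha> * x + \<beta> * y"
proof -
  have "New L \<subseteq> {p. (\<alpha>, \<beta>) \<bullet> p \<ge> C}"
    unfolding New_def using assms(1)
    by (intro hull_minimal convex_halfspace_ge) (auto simp: lattice_emb_def)
  then show ?thesis using assms(2) by auto
qed

section \<open>Minkowski sums with the quadrant as neutral element\<close>

lemma poly_sum_empty [simp]: "poly_sum Q {} = real_quadrant"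
  by (simp add: poly_sum_def)

text \<open>
  The quadrant is neutral for upward closed summands, so the separate clause for the empty sum agrees
  with the recursion that inductions need.
\<close>
lemma poly_sum_insert:
  assumes "finite I" "i \<notin> I" "upward_closed (Q i)"
  shows "poly_sum Q (insert i I) = Q i + poly_sum Q I"
  using assms by (auto simp: poly_sum_def plus_real_quadrant_if_upward_closed)

lemma upward_closed_poly_sum:
  assumes "finite I" "\<And>i. i \<in> I \<Longrightarrow> upward_closed (Q i)"
  shows "upward_closed (poly_sum Q I)"
  using assms
  by (induction I) (auto simp: upward_closed_real_quadrant poly_sum_insert upward_closed_plus)

lemma convex_poly_sum:
  assumes "\<And>i. i \<in> I \<Longrightarrow> convex (Q i)"
  shows "convex (poly_sum Q I)"
  using assms by (auto simp: poly_sum_def convex_real_quadrant intro: convex_set_sum)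

lemma sum_in_poly_sum:
  assumes "finite I" "\<And>i. i \<in> I \<Longrightarrow> upward_closed (Q i)" "\<And>i. i \<in> I \<Longrightarrow> v i \<in> Q i"
  shows "sum v I \<in> poly_sum Q I"
  using assms
proof (induction I)
  case empty
  then show ?case by (simp add: real_quadrant_def zero_prod_def)
next
  case (insert i I)
  then show ?case by (simp add: poly_sum_insert set_plus_intro)
qed

text \<open>
  Lower bounds of a linear form add up. The form has to be nonnegative on the quadrant, which is the
  empty sum; this is the reason for \<open>0 \<le> c\<close>.
\<close>
lemma poly_sum_lower_bound:
  assumes "finite I" "\<And>i. i \<in> I \<Longrightarrow> upward_closed (Q i)" "0 \<le> c"
    and "\<And>i x y. i \<in> I \<Longrightarrow> (x, y) \<in> Q i \<Longrightarrow> w i \<le> x + c * y"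
    and "(x, y) \<in> poly_sum Q I"
  shows "sum w I \<le> x + c * y"
  using assms
proof (induction I arbitrary: x y)
  case empty
  then show ?case by (simp add: real_quadrant_def)
next
  case (insert i I)
  then have "(x, y) \<in> Q i + poly_sum Q I" by (simp add: poly_sum_insert)
  then obtain p q r s where pq: "(p, q) \<in> Q i" "(r, s) \<in> poly_sum Q I" "x = p + r" "y = q + s"
    by (auto simp: set_plus_def)
  have "w i \<le> p + c * q" using insert.prems pq(1) by auto
  moreover have "sum w I \<le> r + c * s" using insert.prems pq(2) by (intro insert.IH) auto
  ultimately show ?case using insert.hyps pq by (simp add: algebra_simps)
qed

section \<open>The region with prescribed multiplicities of its edges\<close>

text \<open>
  The point \<open>(vertex_x a k, vertex_y a k)\<close> is reached from the origin by laying the vectors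
  \<open>a j \<cdot> (j, -1)\<close> with \<open>1 \<le> j < k\<close> one after the other. It is the point where the edges of slope \<open>-1/j\<close>,
  \<open>j < k\<close>, end and flatter ones begin.
\<close>
definition vertex_x :: "(nat \<Rightarrow> nat) \<Rightarrow> nat \<Rightarrow> int" where
  "vertex_x a k = (\<Sum>j\<in>{1..<k}. int (a j) * int j)"

definition vertex_y :: "(nat \<Rightarrow> nat) \<Rightarrow> nat \<Rightarrow> int" where
  "vertex_y a k = - (\<Sum>j\<in>{1..<k}. int (a j))"

text \<open>
  The minimum of \<open>x + k y\<close> over \<open>region a\<close>: the form decreases along the edges with \<open>j < k\<close> and does not
  decrease along the others, so it is minimal at the vertex between them.
\<close>
definition support_value :: "(nat \<Rightarrow> nat) \<Rightarrow> nat \<Rightarrow> int" where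
  "support_value a k = vertex_x a k + int k * vertex_y a k"

definition region :: "(nat \<Rightarrow> nat) \<Rightarrow> (real \<times> real) set" where
  "region a = {(x, y). \<forall>k. real_of_int (support_value a k) \<le> x + real k * y}"

lemma vertex_x_0 [simp]: "vertex_x a 0 = 0" and vertex_x_1 [simp]: "vertex_x a (Suc 0) = 0"
  and vertex_y_0 [simp]: "vertex_y a 0 = 0" and vertex_y_1 [simp]: "vertex_y a (Suc 0) = 0"
  by (simp_all add: vertex_x_def vertex_y_def)

lemma vertex_x_Suc: "1 \<le> k \<Longrightarrow> vertex_x a (Suc k) = vertex_x a k + int (a k) * int k"
  and vertex_y_Suc: "1 \<le> k \<Longrightarrow> vertex_y a (Suc k) = vertex_y a k - int (a k)"
  by (simp_all add: vertex_x_def vertex_y_def sum.atLeastLessThan_Suc)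

lemma support_value_0 [simp]: "support_value a 0 = 0" and support_value_1 [simp]: "support_value a (Suc 0) = 0"
  by (simp_all add: support_value_def)

text \<open>
  The form \<open>x + k y\<close> is constant on the edge of slope \<open>-1/k\<close>, so both of its end points give the minimum.
\<close>
lemma support_value_eq_next_vertex: "support_value a k = vertex_x a (Suc k) + int k * vertex_y a (Suc k)"
  by (cases "k = 0") (simp_all add: support_value_def vertex_x_Suc vertex_y_Suc algebra_simps)

lemma support_value_Suc: "support_value a (Suc k) = support_value a k + vertex_y a (Suc k)"
  unfolding support_value_eq_next_vertex[of a k] by (simp add: support_value_def algebra_simps)

lemma support_value_second_difference:
  assumes "1 \<le> k"
  shows "int (a k) = 2 * support_value a k - support_value a (Suc k) - support_value a (k - 1)"
  using support_value_Suc[of a k] support_value_Suc[of a "k - 1"] vertex_y_Suc[OF assms, of a] assms by simp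

text \<open>
  Passing from vertex \<open>m\<close> to vertex \<open>m + 1\<close> changes \<open>x + k y\<close> by \<open>a m (m - k)\<close>. Hence the values decrease
  up to \<open>m = k\<close> and increase from there on.
\<close>
lemma support_value_le_vertex: "support_value a k \<le> vertex_x a m + int k * vertex_y a m"
proof (cases "k \<le> m")
  case True
  then show ?thesis
  proof (induction m rule: dec_induct)
    case base
    then show ?case by (simp add: support_value_def)
  next
    case (step m)
    have "vertex_x a m + int k * vertex_y a m \<le> vertex_x a (Suc m) + int k * vertex_y a (Suc m)"
    proof (cases "m = 0")
      case False
      have "0 \<le> int (a m) * (int m - int k)" using step.hyps by simp
      then show ?thesis using False by (simp add: vertex_x_Suc vertex_y_Suc algebra_simps)
    qed simp
    then show ?case using step.IH by linarith
  qed
next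
  case False
  then have "m \<le> k" by simp
  then show ?thesis
  proof (induction m rule: inc_induct)
    case base
    then show ?case by (simp add: support_value_def)
  next
    case (step m)
    have "vertex_x a (Suc m) + int k * vertex_y a (Suc m) \<le> vertex_x a m + int k * vertex_y a m"
    proof (cases "m = 0")
      case False
      have "0 \<le> int (a m) * (int k - int m)" using step.hyps by simp
      then show ?thesis using False by (simp add: vertex_x_Suc vertex_y_Suc algebra_simps)
    qed simp
    then show ?case using step.IH by linarith
  qed
qed

lemma vertex_in_region: "(real_of_int (vertex_x a m), real_of_int (vertex_y a m)) \<in> region a"
proof -
  have "real_of_int (support_value a k) \<le> real_of_int (vertex_x a m + int k * vertex_y a m)" for k
    using support_value_le_vertex[of a k m] by (simp only: of_int_le_iff)
  then show ?thesis by (simp add: region_def)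
qed

lemma regionD: "(x, y) \<in> region a \<Longrightarrow> real_of_int (support_value a k) \<le> x + real k * y"
  by (simp add: region_def)

lemma region_nonneg: "(x, y) \<in> region a \<Longrightarrow> 0 \<le> x"
  using regionD[of x y a 0] by simp

lemma region_sum_nonneg: "(x, y) \<in> region a \<Longrightarrow> 0 \<le> x + y"
  using regionD[of x y a 1] by simp

lemma upward_closed_region: "upward_closed (region a)"
  unfolding upward_closed_def
proof (intro allI impI)
  fix x y x' y' assume h: "(x, y) \<in> region a \<and> x \<le> x' \<and> y \<le> y'"
  have "real_of_int (support_value a k) \<le> x' + real k * y'" for k
  proof -
    have "real k * y \<le> real k * y'" using h by (intro mult_left_mono) auto
    then show ?thesis using h regionD[of x y a k] by linarith
  qed
  then show "(x', y') \<in> region a" by (simp add: region_def)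
qed

lemma convex_region: "convex (region a)"
proof -
  have "region a = (\<Inter>k. {p. (1, real k) \<bullet> p \<ge> real_of_int (support_value a k)})"
    by (auto simp: region_def)
  then show ?thesis by (auto intro!: convex_INT convex_halfspace_ge)
qed

lemma quadrant_in_region: "0 \<le> x \<Longrightarrow> 0 \<le> y \<Longrightarrow> (x, y) \<in> region a"
  using upward_closedD[OF upward_closed_region vertex_in_region[of a 0], of x y] by simp

lemma vertex_stable:
  assumes "\<And>j. n < j \<Longrightarrow> a j = 0" "n < k"
  shows "vertex_x a k = vertex_x a (Suc n)" "vertex_y a k = vertex_y a (Suc n)"
  using assms(2) by (induction k) (auto simp: less_Suc_eq vertex_x_Suc vertex_y_Suc assms(1))

text \<open>
  The inequality for a large \<open>k\<close> says, up to an error of order \<open>1/k\<close>, that \<open>y\<close> is at least the height of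
  the last vertex.
\<close>
lemma region_ge_last_vertex:
  assumes fin: "\<And>j. n < j \<Longrightarrow> a j = 0" and "(x, y) \<in> region a"
  shows "real_of_int (vertex_y a (Suc n)) \<le> y"
proof (rule ccontr)
  let ?X = "real_of_int (vertex_x a (Suc n))" and ?Y = "real_of_int (vertex_y a (Suc n))"
  assume "\<not> ?Y \<le> y"
  then have pos: "0 < ?Y - y" by simp
  then obtain N where N: "(x - ?X) / (?Y - y) < real N" using reals_Archimedean2 by blast
  define k where "k = N + Suc n"
  have "(x - ?X) / (?Y - y) < real k" using N by (simp add: k_def)
  then have "x - ?X < real k * (?Y - y)" using pos by (simp add: pos_divide_less_eq)
  moreover have "?X + real k * ?Y \<le> x + real k * y"
    using regionD[OF assms(2), of k] vertex_stable[of n a k, OF fin]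
    by (simp add: support_value_def k_def)
  ultimately show False by (simp add: algebra_simps)
qed

text \<open>
  A point of the region lies above the edge over its first coordinate, or to the upper right of the last
  vertex; so the region is the smallest convex upward closed set that contains the vertices.
\<close>
lemma region_subset_if_vertices:
  assumes fin: "\<And>j. n < j \<Longrightarrow> a j = 0" and "convex T" "upward_closed T"
    and vert: "\<And>k. (real_of_int (vertex_x a k), real_of_int (vertex_y a k)) \<in> T"
  shows "region a \<subseteq> T"
proof (rule subrelI)
  fix x y assume xy: "(x, y) \<in> region a"
  show "(x, y) \<in> T"
  proof (cases "real_of_int (vertex_x a (Suc n)) \<le> x")
    case True
    then show ?thesis
      using upward_closedD[OF \<open>upward_closed T\<close> vert[of "Suc n"]] region_ge_last_vertex[OF fin xy] by blast
  next
    case False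
    \<comment> \<open>The least such \<open>k\<close> is the index of the right end of the edge below the point.\<close>
    define k where "k = (LEAST k. x < real_of_int (vertex_x a k))"
    have k: "x < real_of_int (vertex_x a k)" and least: "\<And>i. i < k \<Longrightarrow> real_of_int (vertex_x a i) \<le> x"
      using False LeastI[of "\<lambda>k. x < real_of_int (vertex_x a k)" "Suc n"] not_less_Least
      unfolding k_def by force+
    have "k \<noteq> 0" "k \<noteq> 1" using k region_nonneg[OF xy] by (auto intro!: Nat.gr0I)
    then obtain m where m: "k = Suc m" "1 \<le> m" by (cases k) auto
    define X Y A where "X = real_of_int (vertex_x a m)" "Y = real_of_int (vertex_y a m)" "A = real (a m)"
    have x1: "X \<le> x" using least[of m] m by (simp add: X_Y_A_def)
    have x2: "x < X + A * real m" using k m by (simp add: X_Y_A_def vertex_x_Suc)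
    have y: "X + real m * Y \<le> x + real m * y"
      using regionD[OF xy, of m] by (simp add: support_value_def X_Y_A_def)
    have Am: "0 < A * real m" using x1 x2 by linarith
    define t where "t = (x - X) / (A * real m)"
    have t: "0 \<le> t" "t \<le> 1" using x1 x2 Am by (auto simp: t_def)
    have "(1 - t) *\<^sub>R (X, Y) + t *\<^sub>R (X + A * real m, Y - A) \<in> T"
      using vert[of m] vert[of "Suc m"] m t \<open>convex T\<close>
      by (intro convexD) (auto simp: X_Y_A_def vertex_x_Suc vertex_y_Suc)
    moreover have "(1 - t) *\<^sub>R (X, Y) + t *\<^sub>R (X + A * real m, Y - A) = (x, Y - t * A)"
    proof -
      have "t * (A * real m) = x - X" using Am by (metis t_def less_irrefl nonzero_eq_divide_eq)
      then show ?thesis by (simp add: algebra_simps)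
    qed
    moreover have "Y - t * A \<le> y"
    proof -
      have "A \<noteq> 0" using Am by auto
      then have "t * A = (x - X) / real m" by (simp add: t_def)
      moreover have "Y - y \<le> (x - X) / real m"
        using y m(2) by (simp add: field_simps)
      ultimately show ?thesis by linarith
    qed
    ultimately show ?thesis using upward_closedD[OF \<open>upward_closed T\<close>] by fastforce
  qed
qed

text \<open>
  Beyond the last vertex all inequalities follow from the one at \<open>k = n + 1\<close> and the bound on the height,
  which leaves finitely many half planes.
\<close>
lemma polyhedron_region:
  assumes fin: "\<And>j. n < j \<Longrightarrow> a j = 0"
  shows "polyhedron (region a)"
proof -
  let ?H = "\<lambda>k. {p :: real \<times> real. (1, real k) \<bullet> p \<ge> real_of_int (support_value a k)}"
  let ?V = "{p :: real \<times> real. (0, 1) \<bullet> p \<ge> real_of_int (vertex_y a (Suc n))}"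
  have "region a = \<Inter> (?H ` {..Suc n}) \<inter> ?V"
  proof (intro equalityI subrelI)
    fix x y assume "(x, y) \<in> region a"
    then show "(x, y) \<in> \<Inter> (?H ` {..Suc n}) \<inter> ?V"
      using regionD[of x y a] region_ge_last_vertex[OF fin] by auto
  next
    fix x y :: real assume h: "(x, y) \<in> \<Inter> (?H ` {..Suc n}) \<inter> ?V"
    have le: "real_of_int (support_value a k) \<le> x + real k * y" if "k \<le> Suc n" for k
      using h that by auto
    have "real_of_int (support_value a k) \<le> x + real k * y" for k
    proof (cases "k \<le> Suc n")
      case True
      then show ?thesis by (rule le)
    next
      case False
      have 1: "real_of_int (support_value a (Suc n)) \<le> x + real (Suc n) * y" by (intro le) simp
      have "(real k - real (Suc n)) * real_of_int (vertex_y a (Suc n)) \<le> (real k - real (Suc n)) * y"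
        using h False by (intro mult_left_mono) auto
      with 1 show ?thesis
        using vertex_stable[of n a k, OF fin] False by (simp add: support_value_def algebra_simps)
    qed
    then show "(x, y) \<in> region a" by (simp add: region_def)
  qed
  moreover have "polyhedron (\<Inter> (?H ` {..Suc n}) \<inter> ?V)"
    by (intro polyhedron_Int polyhedron_Inter) (auto intro: polyhedron_halfspace_ge)
  ultimately show ?thesis by simp
qed

section \<open>The region of finitely many edges as a Newton polyhedron\<close>

lemma lattice_points_region_iff:
  "(x, y) \<in> lattice_points (region a) \<longleftrightarrow> (\<forall>k. support_value a k \<le> x + int k * y)"
proof -
  have "real_of_int (support_value a k) \<le> real_of_int x + real k * real_of_int y
      \<longleftrightarrow> support_value a k \<le> x + int k * y" for k
    by (metis of_int_add of_int_le_iff of_int_mult of_int_of_nat_eq)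
  then show ?thesis by (simp add: lattice_points_def lattice_emb_def region_def)
qed

lemma New_lattice_points_subset: "New (lattice_points T) \<subseteq> T" if "convex T"
  unfolding New_def lattice_points_def using that by (intro hull_minimal) auto

lemma monoid_submodule_lattice_points:
  assumes "upward_closed T"
  shows "monoid_submodule (lattice_points T)"
  using assms
  by (auto simp: monoid_submodule_def lattice_points_def lattice_emb_def nat_quadrant_def
      set_plus_def elim!: upward_closedD)

lemma New_lattice_points_region:
  assumes fin: "\<And>j. n < j \<Longrightarrow> a j = 0"
  shows "New (lattice_points (region a)) = region a"
proof
  show "New (lattice_points (region a)) \<subseteq> region a"
    by (rule New_lattice_points_subset[OF convex_region])
  show "region a \<subseteq> New (lattice_points (region a))"
  proof (rule region_subset_if_vertices[OF fin])
    show "convex (New (lattice_points (region a)))" by (rule convex_New)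
    show "upward_closed (New (lattice_points (region a)))"
      by (intro upward_closed_New monoid_submodule_lattice_points upward_closed_region)
    show "(real_of_int (vertex_x a k), real_of_int (vertex_y a k)) \<in> New (lattice_points (region a))" for k
      using vertex_in_region
      by (intro lattice_emb_in_New) (auto simp: lattice_points_def lattice_emb_def)
  qed
qed

lemma aff_dim_eq_2:
  fixes T :: "(real \<times> real) set"
  assumes "upward_closed T" "T \<noteq> {}"
  shows "aff_dim T = 2"
proof -
  obtain x y where "(x, y) \<in> T" using assms(2) by auto
  then have "{x<..} \<times> {y<..} \<subseteq> T" by (auto elim!: upward_closedD[OF assms(1)])
  moreover have "aff_dim ({x<..} \<times> {y<..}) = 2"
    by (subst aff_dim_open) (auto intro: open_Times)
  ultimately have "2 \<le> aff_dim T" using aff_dim_subset by metis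
  moreover have "aff_dim T \<le> 2" using aff_dim_le_DIM[of T] by simp
  ultimately show ?thesis by simp
qed

text \<open>
  This is the only way in which the dimension of a facet is used when the facets of a region are listed.
\<close>
lemma not_subset_singleton_if_facet:
  fixes T :: "(real \<times> real) set"
  assumes "upward_closed T" "S facet_of T"
  shows "\<not> S \<subseteq> {p}"
proof
  assume "S \<subseteq> {p}"
  then have "aff_dim S \<le> 0" using aff_dim_subset aff_dim_sing by metis
  moreover have "aff_dim S = 1"
    using assms aff_dim_eq_2[OF assms(1)] facet_of_imp_subset[OF assms(2)]
    by (auto simp: facet_of_def)
  ultimately show False by simp
qed

lemma not_bounded_vertical: "\<not> bounded ({0} \<times> {0::real..} :: (real \<times> real) set)"
proof
  assume "bounded ({0} \<times> {0::real..} :: (real \<times> real) set)"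
  then have "bounded (snd ` ({0} \<times> {0::real..} :: (real \<times> real) set))" by (rule bounded_snd)
  then have "bdd_above {0::real..}" by (auto dest: bounded_imp_bdd_above)
  then obtain m where "\<And>t::real. 0 \<le> t \<Longrightarrow> t \<le> m" by (auto simp: bdd_above_def)
  from this[of "max 0 m + 1"] show False by linarith
qed

lemma not_bounded_horizontal: "\<not> bounded ({c..} \<times> {d} :: (real \<times> real) set)"
proof
  assume "bounded ({c..} \<times> {d} :: (real \<times> real) set)"
  then have "bounded (fst ` ({c..} \<times> {d} :: (real \<times> real) set))" by (rule bounded_fst)
  then have "bdd_above {c..}" by (auto dest: bounded_imp_bdd_above)
  then obtain m where "\<And>t. c \<le> t \<Longrightarrow> t \<le> m" by (auto simp: bdd_above_def)
  from this[of "max c m + 1"] show False by linarith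
qed

text \<open>
  On the line \<open>x + j y = support_value a j\<close>, the inequalities for \<open>j + 1\<close> and \<open>j - 1\<close> bound \<open>y\<close> from below and
  above by the heights of the two vertices.
\<close>
lemma edge_of_region:
  fixes a :: "nat \<Rightarrow> nat"
  defines "v \<equiv> \<lambda>k. lattice_emb (vertex_x a k, vertex_y a k)"
  assumes "1 \<le> j"
  shows "region a \<inter> {(x, y). x + real j * y = real_of_int (support_value a j)}
    = closed_segment (v j) (v (Suc j))"
proof (intro equalityI subrelI)
  fix x y assume "(x, y) \<in> region a \<inter> {(x, y). x + real j * y = real_of_int (support_value a j)}"
  then have xy: "(x, y) \<in> region a" and eq: "x + real j * y = real_of_int (support_value a j)" by auto
  have x: "x = real_of_int (vertex_x a j) + real j * (real_of_int (vertex_y a j) - y)"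
    using eq by (simp add: support_value_def algebra_simps)
  have lo: "real_of_int (vertex_y a j) - real (a j) \<le> y"
    using regionD[OF xy, of "Suc j"] eq vertex_y_Suc[OF assms(2), of a]
    by (simp add: support_value_Suc algebra_simps)
  have "support_value a j = support_value a (j - 1) + vertex_y a j" using support_value_Suc[of a "j - 1"] assms by simp
  then have hi: "y \<le> real_of_int (vertex_y a j)"
    using regionD[OF xy, of "j - 1"] eq assms by (simp add: algebra_simps of_nat_diff)
  show "(x, y) \<in> closed_segment (v j) (v (Suc j))"
  proof (cases "a j = 0")
    case True
    then show ?thesis using x lo hi assms by (simp add: v_def lattice_emb_def vertex_x_Suc vertex_y_Suc)
  next
    case False
    define t where "t = (real_of_int (vertex_y a j) - y) / real (a j)"
    have t: "0 \<le> t" "t \<le> 1" using lo hi False by (auto simp: t_def field_simps)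
    have ta: "t * real (a j) = real_of_int (vertex_y a j) - y" using False by (simp add: t_def)
    have "(x, y) = (1 - t) *\<^sub>R v j + t *\<^sub>R v (Suc j)"
    proof -
      have "(1 - t) *\<^sub>R v j + t *\<^sub>R v (Suc j) =
        (real_of_int (vertex_x a j) + real j * (t * real (a j)), real_of_int (vertex_y a j) - t * real (a j))"
        using assms by (simp add: v_def lattice_emb_def vertex_x_Suc vertex_y_Suc algebra_simps)
      then show ?thesis unfolding ta x by simp
    qed
    then show ?thesis using t by (auto simp: closed_segment_def)
  qed
next
  have "closed_segment (v j) (v (Suc j)) \<subseteq> region a \<inter> {p. (1, real j) \<bullet> p = real_of_int (support_value a j)}"
  proof (rule closed_segment_subset)
    show "convex (region a \<inter> {p. (1, real j) \<bullet> p = real_of_int (support_value a j)})"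
      by (intro convex_Int convex_region convex_hyperplane)
  qed (use vertex_in_region[of a j] vertex_in_region[of a "Suc j"] assms in
      \<open>auto simp: v_def lattice_emb_def support_value_def vertex_x_Suc vertex_y_Suc algebra_simps\<close>)
  then show "(x, y) \<in> region a \<inter> {(x, y). x + real j * y = real_of_int (support_value a j)}"
    if "(x, y) \<in> closed_segment (v j) (v (Suc j))" for x y
    using that by auto
qed

text \<open>
  A facet is cut out by a line \<open>\<alpha> x + \<beta> y = B\<close> with \<open>\<alpha>, \<beta> \<ge> 0\<close>. If both are positive, put \<open>\<rho> = \<beta> / \<alpha>\<close> and
  write \<open>\<rho>\<close> as a convex combination of the neighbouring integers \<open>j\<close> and \<open>j + 1\<close>. The two inequalities
  for \<open>j\<close> and \<open>j + 1\<close> meet in one vertex, and unless \<open>\<rho> = j\<close> the facet would consist of this vertex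
  alone.
\<close>
lemma facet_of_region_cases:
  assumes fin: "\<And>j. n < j \<Longrightarrow> a j = 0" and facet: "S facet_of region a"
  obtains (vertical) "S = {0} \<times> {0..}"
    | (horizontal) c d where "S = {c..} \<times> {d}"
    | (edge) j where "1 \<le> j" "a j \<noteq> 0"
        "S = closed_segment (lattice_emb (vertex_x a j, vertex_y a j)) (lattice_emb (vertex_x a (Suc j), vertex_y a (Suc j)))"
proof -
  obtain u b where u: "u \<noteq> 0" "region a \<subseteq> {p. u \<bullet> p \<le> b}" "S = region a \<inter> {p. u \<bullet> p = b}"
    using facet_of_polyhedron[OF polyhedron_region[OF fin] facet] by metis
  define \<alpha> \<beta> B where "\<alpha> = - fst u" and "\<beta> = - snd u" and "B = - b"
  have ge: "B \<le> \<alpha> * x + \<beta> * y" if "(x, y) \<in> region a" for x y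
    using u(2) that by (cases u) (auto simp: \<alpha>_def \<beta>_def B_def)
  have S: "S = region a \<inter> {(x, y). \<alpha> * x + \<beta> * y = B}"
    unfolding u(3) by (cases u) (auto simp: \<alpha>_def \<beta>_def B_def)
  have nontriv: "\<not> S \<subseteq> {p}" for p
    by (rule not_subset_singleton_if_facet[OF upward_closed_region facet])
  \<comment> \<open>If \<open>c\<close> were negative, \<open>c t\<close> would be \<open>B - 1\<close> at \<open>t = (B - 1) / c\<close>.\<close>
  have nonneg: "0 \<le> c" if "\<And>t. 0 \<le> t \<Longrightarrow> B \<le> c * t" for c
  proof (rule ccontr)
    assume "\<not> 0 \<le> c"
    then have c: "c < 0" by simp
    have "B \<le> 0" using that[of 0] by simp
    then have "B \<le> c * ((B - 1) / c)" using c by (intro that) (simp add: zero_le_divide_iff)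
    then show False using c by simp
  qed
  have "0 \<le> \<alpha>" using ge[OF quadrant_in_region, of _ 0] by (intro nonneg) simp
  have "0 \<le> \<beta>" using ge[OF quadrant_in_region, of 0] by (intro nonneg) simp
  consider "\<alpha> = 0" "0 < \<beta>" | "\<beta> = 0" "0 < \<alpha>" | "0 < \<alpha>" "0 < \<beta>"
    using \<open>0 \<le> \<alpha>\<close> \<open>0 \<le> \<beta>\<close> u(1) by (cases u) (fastforce simp: \<alpha>_def \<beta>_def zero_prod_def)
  then show thesis
  proof cases
    case 1
    define c d where "c = real_of_int (vertex_x a (Suc n))" and "d = real_of_int (vertex_y a (Suc n))"
    have v: "(c, d) \<in> region a" using vertex_in_region by (simp add: c_def d_def)
    obtain x0 y0 where "(x0, y0) \<in> S" using nontriv[of "(0, 0)"] by auto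
    then have 0: "(x0, y0) \<in> region a" "\<beta> * y0 = B" using S 1 by auto
    have "\<beta> * d \<le> \<beta> * y0"
      using region_ge_last_vertex[OF fin 0(1)] 1 by (simp add: d_def)
    then have "B = \<beta> * d" using ge[OF v] 1 0 by simp
    then have "S = region a \<inter> {(x, y). y = d}" using S 1 by auto
    moreover have "(x, d) \<in> region a \<longleftrightarrow> c \<le> x" for x
      using regionD[of x d a "Suc n"] upward_closedD[OF upward_closed_region v, of x d]
      by (auto simp: support_value_def c_def d_def)
    ultimately have "S = {c..} \<times> {d}" by auto
    then show ?thesis by (rule horizontal)
  next
    case 2
    obtain x0 y0 where "(x0, y0) \<in> S" using nontriv[of "(0, 0)"] by auto
    then have 0: "0 \<le> x0" "\<alpha> * x0 = B" using S 2 region_nonneg by auto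
    then have "B = 0" using ge[OF quadrant_in_region[of 0 0]] 2 by (auto intro: antisym)
    then have "S = region a \<inter> {(x, y). x = 0}" using S 2 by auto
    moreover have "(0, y) \<in> region a \<longleftrightarrow> 0 \<le> y" for y
      using region_sum_nonneg[of 0 y a] quadrant_in_region[of 0 y] by auto
    ultimately have "S = {0} \<times> {0..}" by auto
    then show ?thesis by (rule vertical)
  next
    case 3
    define \<rho> where "\<rho> = \<beta> / \<alpha>"
    have "0 < \<rho>" using 3 by (simp add: \<rho>_def)
    have ge': "B / \<alpha> \<le> x + \<rho> * y" if "(x, y) \<in> region a" for x y
      using ge[OF that] 3 by (simp add: \<rho>_def field_simps)
    have S': "S = region a \<inter> {(x, y). x + \<rho> * y = B / \<alpha>}"
      unfolding S using 3 by (auto simp: \<rho>_def field_simps)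
    define j where "j = nat \<lfloor>\<rho>\<rfloor>"
    define \<theta> where "\<theta> = \<rho> - real j"
    have \<theta>: "0 \<le> \<theta>" "\<theta> < 1" using \<open>0 < \<rho>\<close> by (auto simp: \<theta>_def j_def) linarith+
    define X Y where "X = real_of_int (vertex_x a (Suc j))" and "Y = real_of_int (vertex_y a (Suc j))"
    have s1: "real_of_int (support_value a j) = X + real j * Y"
      by (simp add: support_value_eq_next_vertex X_def Y_def)
    have s2: "real_of_int (support_value a (Suc j)) = X + real (Suc j) * Y"
      by (simp add: support_value_def X_def Y_def)
    have XY: "(X, Y) \<in> region a" unfolding X_def Y_def by (rule vertex_in_region)
    \<comment> \<open>The form \<open>x + \<rho> y\<close> is a convex combination of the two neighbouring forms, so it can
      only attain its minimum where each of them with a positive weight does.\<close>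
    have tight: "(1 - \<theta>) * (x + real j * y - (X + real j * Y)) = 0 \<and>
        \<theta> * (x + real (Suc j) * y - (X + real (Suc j) * Y)) = 0"
      if "(x, y) \<in> S" for x y
    proof -
      have xy: "(x, y) \<in> region a" "x + \<rho> * y = B / \<alpha>" using that S' by auto
      have "(1 - \<theta>) * (x + real j * y - (X + real j * Y)) +
          \<theta> * (x + real (Suc j) * y - (X + real (Suc j) * Y)) = (x + \<rho> * y) - (X + \<rho> * Y)"
        by (simp add: \<theta>_def algebra_simps)
      also have "\<dots> \<le> 0" using ge'[OF XY] xy by simp
      finally have "(1 - \<theta>) * (x + real j * y - (X + real j * Y)) +
          \<theta> * (x + real (Suc j) * y - (X + real (Suc j) * Y)) \<le> 0" .
      moreover have "0 \<le> (1 - \<theta>) * (x + real j * y - (X + real j * Y))"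
        using regionD[OF xy(1), of j] s1 \<theta> by simp
      moreover have "0 \<le> \<theta> * (x + real (Suc j) * y - (X + real (Suc j) * Y))"
        using regionD[OF xy(1), of "Suc j"] s2 \<theta> by (intro mult_nonneg_nonneg) linarith+
      ultimately show ?thesis by linarith
    qed
    have "\<theta> = 0"
    proof (rule ccontr)
      assume "\<theta> \<noteq> 0"
      have "x = X \<and> y = Y" if "(x, y) \<in> S" for x y
      proof -
        have "x + real j * y = X + real j * Y" "x + real (Suc j) * y = X + real (Suc j) * Y"
          using tight[OF that] \<theta> \<open>\<theta> \<noteq> 0\<close> by simp_all
        moreover from this have "y = Y" by (simp add: algebra_simps)
        ultimately show ?thesis by simp
      qed
      then have "S \<subseteq> {(X, Y)}" by auto
      then show False using nontriv by blast
    qed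
    then have \<rho>: "\<rho> = real j" by (simp add: \<theta>_def)
    then have j: "1 \<le> j" using \<open>0 < \<rho>\<close> by simp
    obtain x0 y0 where x0: "(x0, y0) \<in> S" using nontriv[of "(0, 0)"] by auto
    then have "B / \<alpha> = real_of_int (support_value a j)"
      using tight[OF x0] S' \<open>\<theta> = 0\<close> \<rho> s1 by simp
    then have seg: "S = closed_segment (lattice_emb (vertex_x a j, vertex_y a j))
        (lattice_emb (vertex_x a (Suc j), vertex_y a (Suc j)))"
      using S' \<rho> edge_of_region[OF j] by simp
    moreover have "a j \<noteq> 0"
    proof
      assume "a j = 0"
      then have "S \<subseteq> {lattice_emb (vertex_x a j, vertex_y a j)}"
        using seg vertex_x_Suc[OF j, of a] vertex_y_Suc[OF j, of a] by simp
      then show False using nontriv by blast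
    qed
    ultimately show ?thesis using j by (intro edge)
  qed
qed

lemma vertex_x_nonneg: "0 \<le> vertex_x a k" and vertex_y_nonpos: "vertex_y a k \<le> 0"
  by (auto simp: vertex_x_def vertex_y_def intro!: sum_nonneg)

text \<open>
  The distance \<open>(x - c) + (y - d)\<close> is a natural number that drops along every strictly descending chain.
\<close>
lemma co_artinian_if_bounded_below:
  assumes "\<And>x y. (x, y) \<in> L \<Longrightarrow> c \<le> x \<and> d \<le> y"
  shows "co_artinian L"
  unfolding co_artinian_def
proof
  assume "\<exists>f :: nat \<Rightarrow> int \<times> int. (\<forall>n. f n \<in> L) \<and> (\<forall>n. f (Suc n) < f n)"
  then obtain f :: "nat \<Rightarrow> int \<times> int" where f: "\<And>n. f n \<in> L" "\<And>n. f (Suc n) < f n" by blast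
  define r where "r n = nat (fst (f n) - c + (snd (f n) - d))" for n
  have "r (Suc n) < r n" for n
  proof -
    have "c \<le> fst (f m)" "d \<le> snd (f m)" for m using assms[of "fst (f m)" "snd (f m)"] f(1) by auto
    note this[of n] this[of "Suc n"]
    moreover have "fst (f (Suc n)) + snd (f (Suc n)) < fst (f n) + snd (f n)"
      using f(2)[of n] by (cases "f n"; cases "f (Suc n)") (auto simp: less_le)
    ultimately show ?thesis by (auto simp: r_def)
  qed
  then have "r n + n \<le> r 0" for n
  proof (induction n)
    case (Suc n)
    then show ?case by (metis Suc_leI add_Suc_right le_trans add_Suc add_le_mono1)
  qed simp
  from this[of "Suc (r 0)"] show False by simp
qed

text \<open>
  The last vertex has minimal height, which excludes infinite descending chains as well as falling rays.
\<close>
lemma lattice_points_region_in_calA: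
  assumes fin: "\<And>j. n < j \<Longrightarrow> a j = 0"
  shows "lattice_points (region a) \<in> calA"
proof -
  let ?L = "lattice_points (region a)"
  have New: "New ?L = region a" by (rule New_lattice_points_region[OF fin])
  have mem: "(real_of_int x, real_of_int y) \<in> region a" if "(x, y) \<in> ?L" for x y
    using that by (simp add: lattice_points_def lattice_emb_def)
  have lower: "vertex_y a (Suc n) \<le> y" if "(x, y) \<in> ?L" for x y
    using region_ge_last_vertex[OF fin mem[OF that]] by simp
  have x: "0 \<le> x" if "(x, y) \<in> ?L" for x y
    using region_nonneg[OF mem[OF that]] by simp
  have submodule: "monoid_submodule ?L"
    by (intro monoid_submodule_lattice_points upward_closed_region)
  have artinian: "co_artinian ?L"
    using x lower by (intro co_artinian_if_bounded_below[of _ 0 "vertex_y a (Suc n)"]) auto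
  have closed: "integrally_closed ?L"
    by (simp add: integrally_closed_def New)
  have quadrant: "nat_quadrant \<subseteq> ?L"
    by (auto simp: nat_quadrant_def lattice_points_def lattice_emb_def quadrant_in_region)
  have axis: "0 \<le> b" if "(0, b) \<in> ?L" for b
    using region_sum_nonneg[OF mem[OF that]] by simp
  have no_ray: "\<not> {t *\<^sub>R (r, s) | t. 0 \<le> t} \<subseteq> region a" if "s < 0 \<and> 0 < r" for r s :: real
  proof
    assume ray: "{t *\<^sub>R (r, s) | t. 0 \<le> t} \<subseteq> region a"
    define t where "t = (real_of_int (vertex_y a (Suc n)) - 1) / s"
    have "0 \<le> t" using that vertex_y_nonpos[of a "Suc n"] by (simp add: t_def zero_le_divide_iff)
    then have "(t * r, t * s) \<in> region a" using ray by auto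
    then have "real_of_int (vertex_y a (Suc n)) \<le> t * s" by (intro region_ge_last_vertex[of n a] fin)
    then show False using that by (simp add: t_def)
  qed
  have unbounded: "S = {0} \<times> {0..} \<or> (\<exists>c d. S = {c..} \<times> {d})"
    if h: "S facet_of region a \<and> \<not> bounded S" for S
  proof (rule facet_of_region_cases[of n a S, OF fin conjunct1[OF h]])
    fix j :: nat
    assume "S = closed_segment (lattice_emb (vertex_x a j, vertex_y a j)) (lattice_emb (vertex_x a (Suc j), vertex_y a (Suc j)))"
    then have "bounded S" by (simp only: bounded_closed_segment)
    with h show ?thesis by blast
  qed blast+
  have bounded: "\<exists>c d k m :: int. 0 < k \<and> 0 < m \<and> d \<le> 0 \<and> 0 \<le> c \<and>
      S = closed_segment (lattice_emb (c, d)) (lattice_emb (c + m * k, d - m))"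
    if h: "S facet_of region a \<and> bounded S" for S
  proof (rule facet_of_region_cases[of n a S, OF fin conjunct1[OF h]])
    fix j :: nat
    assume "1 \<le> j" "a j \<noteq> 0"
      "S = closed_segment (lattice_emb (vertex_x a j, vertex_y a j)) (lattice_emb (vertex_x a (Suc j), vertex_y a (Suc j)))"
    then have "0 < int j \<and> 0 < int (a j) \<and> vertex_y a j \<le> 0 \<and> 0 \<le> vertex_x a j \<and>
      S = closed_segment (lattice_emb (vertex_x a j, vertex_y a j))
        (lattice_emb (vertex_x a j + int (a j) * int j, vertex_y a j - int (a j)))"
      using vertex_x_nonneg[of a j] vertex_y_nonpos[of a j] by (simp add: vertex_x_Suc vertex_y_Suc)
    then show ?thesis by blast
  next
    assume "S = {0} \<times> {0..}"
    with h show ?thesis using not_bounded_vertical by simp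
  next
    fix c d assume "S = {c..} \<times> {d}"
    with h show ?thesis using not_bounded_horizontal by simp
  qed
  show ?thesis
    unfolding calA_def New mem_Collect_eq
    by (intro conjI submodule artinian closed quadrant; intro allI impI)
      (erule x axis no_ray unbounded bounded)+
qed

section \<open>Finite Minkowski sums\<close>

lemma New_F_iff: "(x, y) \<in> New (F j) \<longleftrightarrow> (\<exists>t. 0 \<le> t \<and> t \<le> 1 \<and> t * real j \<le> x \<and> - t \<le> y)"
proof
  assume "(x, y) \<in> New (F j)"
  then show "\<exists>t. 0 \<le> t \<and> t \<le> 1 \<and> t * real j \<le> x \<and> - t \<le> y"
    by (fastforce simp: New_F set_plus_def real_quadrant_def closed_segment_def)
next
  assume "\<exists>t. 0 \<le> t \<and> t \<le> 1 \<and> t * real j \<le> x \<and> - t \<le> y"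
  then obtain t where t: "0 \<le> t" "t \<le> 1" "t * real j \<le> x" "- t \<le> y" by blast
  have "(x - t * real j, y + t) + (t * real j, - t) \<in> New (F j)"
    unfolding New_F using t
    by (intro set_plus_intro) (auto simp: real_quadrant_def closed_segment_def intro!: exI[of _ t])
  then show "(x, y) \<in> New (F j)" by simp
qed

lemma upward_closed_New_F: "upward_closed (New (F j))"
  by (simp add: New_F upward_closed_plus upward_closed_real_quadrant)

text \<open>
  The form \<open>x + k y\<close> takes the values \<open>0\<close> and \<open>j - k\<close> at the two vertices.
\<close>
lemma New_F_ge:
  assumes "(x, y) \<in> New (F j)"
  shows "min 0 (real j - real k) \<le> x + real k * y"
proof -
  obtain t where t: "0 \<le> t" "t \<le> 1" "t * real j \<le> x" "- t \<le> y"
    using assms New_F_iff by auto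
  have "real k * (- t) \<le> real k * y" using t(4) by (intro mult_left_mono) auto
  then have "t * (real j - real k) \<le> x + real k * y" using t(3) by (simp add: algebra_simps)
  moreover have "min 0 (real j - real k) \<le> t * (real j - real k)"
  proof (cases "k \<le> j")
    case False
    have "(1 - t) * (real j - real k) \<le> 0" using False t by (intro mult_nonneg_nonpos) auto
    then show ?thesis using False by (simp add: algebra_simps)
  qed (use t in simp)
  ultimately show ?thesis by linarith
qed

lemma upward_closed_poly_mult: "upward_closed Q \<Longrightarrow> upward_closed (poly_mult m Q)"
  by (simp add: poly_mult_def upward_closed_poly_sum)

definition truncation :: "nat \<Rightarrow> (nat \<Rightarrow> nat) \<Rightarrow> nat \<Rightarrow> nat" where
  "truncation n a j = (if j \<le> n then a j else 0)"

lemma truncation_eq_0: "n < j \<Longrightarrow> truncation n a j = 0"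
  by (simp add: truncation_def)

lemma vertex_truncation:
  "vertex_x (truncation n a) k = (\<Sum>j\<in>{1..n}. if j < k then int (a j) * int j else 0)"
  "vertex_y (truncation n a) k = (\<Sum>j\<in>{1..n}. if j < k then - int (a j) else 0)"
proof -
  have "vertex_x (truncation n a) k = (\<Sum>j\<in>{1..<k} \<inter> {1..n}. int (a j) * int j)"
    unfolding vertex_x_def by (rule sum.mono_neutral_cong_right) (auto simp: truncation_def)
  also have "\<dots> = (\<Sum>j\<in>{1..n}. if j < k then int (a j) * int j else 0)"
    by (rule sum.mono_neutral_cong_left) auto
  finally show "vertex_x (truncation n a) k = \<dots>" .
  have "vertex_y (truncation n a) k = (\<Sum>j\<in>{1..<k} \<inter> {1..n}. - int (a j))"
    unfolding vertex_y_def sum_negf[symmetric]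
    by (rule sum.mono_neutral_cong_right) (auto simp: truncation_def)
  also have "\<dots> = (\<Sum>j\<in>{1..n}. if j < k then - int (a j) else 0)"
    by (rule sum.mono_neutral_cong_left) auto
  finally show "vertex_y (truncation n a) k = \<dots>" .
qed

lemma support_value_truncation: "support_value (truncation n a) k = (\<Sum>j\<in>{1..n}. int (a j) * min 0 (int j - int k))"
  unfolding support_value_def vertex_truncation sum_distrib_left sum.distrib[symmetric]
  by (rule sum.cong) (auto simp: algebra_simps)

text \<open>
  The lower bounds of the summands add up to the support values of the region. Conversely, the sum is
  convex and upward closed, and each vertex of the region is the sum of the vertices of the summands in
  the same direction.
\<close>
lemma poly_sum_eq_region:
  "poly_sum (\<lambda>j. poly_mult (a j) (New (F j))) {1..n} = region (truncation n a)"
    (is "poly_sum ?Q _ = _")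
proof
  have Q: "upward_closed (?Q j)" for j by (intro upward_closed_poly_mult upward_closed_New_F)
  have Q_ge: "real (a j) * min 0 (real j - real k) \<le> x + real k * y" if "(x, y) \<in> ?Q j" for j k x y
  proof -
    have "(\<Sum>i<a j. min 0 (real j - real k)) \<le> x + real k * y"
      using that unfolding poly_mult_def
      by (intro poly_sum_lower_bound[where Q = "\<lambda>_. New (F j)"]) (auto intro: upward_closed_New_F New_F_ge)
    then show ?thesis by simp
  qed
  show "poly_sum ?Q {1..n} \<subseteq> region (truncation n a)"
  proof (rule subrelI)
    fix x y assume xy: "(x, y) \<in> poly_sum ?Q {1..n}"
    have "real_of_int (support_value (truncation n a) k) \<le> x + real k * y" for k
    proof -
      have "real_of_int (support_value (truncation n a) k) = (\<Sum>j\<in>{1..n}. real (a j) * min 0 (real j - real k))"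
        unfolding support_value_truncation by (auto simp: min_def intro!: sum.cong)
      also have "\<dots> \<le> x + real k * y"
        by (rule poly_sum_lower_bound[OF _ _ _ Q_ge xy]) (auto intro: Q)
      finally show ?thesis .
    qed
    then show "(x, y) \<in> region (truncation n a)" by (simp add: region_def)
  qed
  show "region (truncation n a) \<subseteq> poly_sum ?Q {1..n}"
  proof (rule region_subset_if_vertices[OF truncation_eq_0])
    show "convex (poly_sum ?Q {1..n})"
      unfolding poly_mult_def by (intro convex_poly_sum convex_New)
    show "upward_closed (poly_sum ?Q {1..n})" by (intro upward_closed_poly_sum Q) simp
    show "(real_of_int (vertex_x (truncation n a) k), real_of_int (vertex_y (truncation n a) k)) \<in> poly_sum ?Q {1..n}" for k
    proof -
      \<comment> \<open>The form \<open>x + k y\<close> is minimal on \<open>New (F j)\<close> at \<open>(j, -1)\<close> if \<open>j < k\<close>, and at the origin otherwise.\<close>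
      define v :: "nat \<Rightarrow> real \<times> real" where
        "v j = (if j < k then (real (a j) * real j, - real (a j)) else 0)" for j
      have "v j \<in> ?Q j" for j
      proof -
        define w :: "real \<times> real" where "w = (if j < k then (real j, - 1) else 0)"
        have "w \<in> New (F j)"
          by (auto simp: w_def New_F_iff zero_prod_def intro: exI[of _ 0] exI[of _ 1])
        then have "(\<Sum>i<a j. w) \<in> ?Q j"
          unfolding poly_mult_def by (intro sum_in_poly_sum upward_closed_New_F) auto
        moreover have "(\<Sum>i<a j. w) = v j" by (simp add: w_def v_def sum_constant_scaleR)
        ultimately show ?thesis by simp
      qed
      then have "sum v {1..n} \<in> poly_sum ?Q {1..n}" by (intro sum_in_poly_sum Q) auto
      moreover have "sum v {1..n} = (real_of_int (vertex_x (truncation n a) k), real_of_int (vertex_y (truncation n a) k))"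
        unfolding vertex_truncation
        by (auto simp: prod_eq_iff fst_sum snd_sum v_def intro!: sum.cong)
      ultimately show ?thesis by simp
    qed
  qed
qed

section \<open>Convergence of the partial sums\<close>

text \<open>
  Cutting \<open>a\<close> off after \<open>n\<close> does not affect the support values up to \<open>n + 1\<close> and continues them with the
  constant slope \<open>vertex_y a (n + 1)\<close>. So a lattice point of the whole region belongs to the truncated one
  as soon as its height is at least that slope. This happens eventually: otherwise, the slopes being
  integers, they would all be at least \<open>y + 1\<close>, and \<open>x + k y \<ge> k (y + 1)\<close> fails for \<open>k > x\<close>.
\<close>
lemma eventually_in_truncated_region:
  "\<forall>\<^sub>F n in sequentially. p \<in> lattice_points (region (truncation n a)) \<longleftrightarrow> p \<in> lattice_points (region a)"
proof -
  obtain x y where p: "p = (x, y)" by (cases p)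
  have vertex: "vertex_x (truncation n a) k = vertex_x a k" "vertex_y (truncation n a) k = vertex_y a k" if "k \<le> Suc n" for n k
    using that by (auto simp: vertex_x_def vertex_y_def truncation_def intro!: sum.cong)
  have stable: "vertex_x (truncation n a) k = vertex_x a (Suc n)" "vertex_y (truncation n a) k = vertex_y a (Suc n)" if "n < k" for n k
    using vertex_stable[of n "truncation n a", OF truncation_eq_0 that] vertex[of "Suc n" n] by auto
  show ?thesis
  proof (cases "p \<in> lattice_points (region a)")
    case True
    then have le: "support_value a k \<le> x + int k * y" for k using p lattice_points_region_iff by auto
    have x: "0 \<le> x" using le[of 0] by simp
    have "\<exists>n. vertex_y a (Suc n) \<le> y"
    proof (rule ccontr)
      assume "\<not> (\<exists>n. vertex_y a (Suc n) \<le> y)"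
      then have *: "y + 1 \<le> vertex_y a (Suc n)" for n by (meson not_le zless_imp_add1_zle)
      have "int k * (y + 1) \<le> support_value a k" for k
      proof (induction k)
        case (Suc k)
        then show ?case using *[of k] by (simp add: support_value_Suc algebra_simps)
      qed simp
      from this[of "nat (x + 1)"] le[of "nat (x + 1)"] show False using x by (simp add: algebra_simps)
    qed
    then obtain N where N: "vertex_y a (Suc N) \<le> y" by blast
    have mono: "vertex_y a (Suc n) \<le> vertex_y a (Suc N)" if "N \<le> n" for n
      using that by (induction n rule: dec_induct) (auto simp: vertex_y_Suc[of "Suc _"])
    have "support_value (truncation n a) k \<le> x + int k * y" if "N \<le> n" for n k
    proof (cases "k \<le> Suc n")
      case True
      then show ?thesis using le[of k] by (simp add: support_value_def vertex)
    next
      case False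
      have "(int k - int (Suc n)) * vertex_y a (Suc n) \<le> (int k - int (Suc n)) * y"
        using False N mono[OF that] by (intro mult_left_mono) auto
      moreover have "support_value (truncation n a) k = vertex_x a (Suc n) + int k * vertex_y a (Suc n)"
        using False by (simp add: support_value_def stable)
      ultimately show ?thesis using le[of "Suc n"] by (simp add: support_value_def algebra_simps)
    qed
    then have "\<forall>\<^sub>F n in sequentially. \<forall>k. support_value (truncation n a) k \<le> x + int k * y"
      by (intro eventually_mono[OF eventually_ge_at_top[of N]]) auto
    then show ?thesis using True by (auto simp: p lattice_points_region_iff elim: eventually_mono)
  next
    case False
    then obtain k where k: "\<not> support_value a k \<le> x + int k * y" using p lattice_points_region_iff by auto
    have "p \<notin> lattice_points (region (truncation n a))" if "k \<le> n" for n
    proof -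
      have "support_value (truncation n a) k = support_value a k" using that by (simp add: support_value_def vertex)
      then show ?thesis using k by (auto simp: p lattice_points_region_iff intro!: exI[of _ k])
    qed
    then show ?thesis
      using False by (intro eventually_mono[OF eventually_ge_at_top[of k]]) auto
  qed
qed

lemma multiplicities_unique:
  assumes "lattice_points (region a) = lattice_points (region b)" "1 \<le> j"
  shows "a j = b j"
proof -
  have le: "support_value a k \<le> support_value b k" if "lattice_points (region a) = lattice_points (region b)" for a b k
  proof -
    have "(vertex_x b k, vertex_y b k) \<in> lattice_points (region a)"
      unfolding that using vertex_in_region by (simp add: lattice_points_def lattice_emb_def)
    then have "support_value a k \<le> vertex_x b k + int k * vertex_y b k" by (simp add: lattice_points_region_iff)
    then show ?thesis by (simp add: support_value_def)
  qed
  have "support_value a k = support_value b k" for k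
    using le assms(1) by (simp add: antisym)
  then have "int (a j) = int (b j)"
    using support_value_second_difference[OF assms(2)] by simp
  then show ?thesis by simp
qed

text \<open>
  A sequence converges in a pullback topology if it eventually stays in the carrier set and its image
  converges. The carrier has to be mentioned separately, because it is open in its own topology.
\<close>
lemma limitin_pullback_topology:
  "limitin (pullback_topology A f T) g l net \<longleftrightarrow>
    l \<in> A \<and> (\<forall>\<^sub>F n in net. g n \<in> A) \<and> limitin T (\<lambda>n. f (g n)) (f l) net"
proof
  assume L: "limitin (pullback_topology A f T) g l net"
  then have l: "l \<in> A" "f l \<in> topspace T"
    using limitin_topspace[OF L] by (auto simp: topspace_pullback_topology)
  have ev: "\<forall>\<^sub>F n in net. g n \<in> f -` U \<inter> A" if "openin T U" "f l \<in> U" for U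
    using limitinD[OF L, of "f -` U \<inter> A"] that l by (auto simp: openin_pullback_topology)
  have "\<forall>\<^sub>F n in net. g n \<in> A"
    using ev[OF openin_topspace l(2)] by (auto elim: eventually_mono)
  moreover have "limitin T (\<lambda>n. f (g n)) (f l) net"
    unfolding limitin_def
  proof (intro conjI allI impI l)
    fix U assume "openin T U \<and> f l \<in> U"
    then have "\<forall>\<^sub>F n in net. g n \<in> f -` U \<inter> A" by (intro ev) auto
    then show "\<forall>\<^sub>F n in net. f (g n) \<in> U" by (rule eventually_mono) simp
  qed
  ultimately show "l \<in> A \<and> (\<forall>\<^sub>F n in net. g n \<in> A) \<and> limitin T (\<lambda>n. f (g n)) (f l) net"
    using l by blast
next
  assume R: "l \<in> A \<and> (\<forall>\<^sub>F n in net. g n \<in> A) \<and> limitin T (\<lambda>n. f (g n)) (f l) net"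
  then show "limitin (pullback_topology A f T) g l net"
    unfolding limitin_def
  proof (intro conjI allI impI)
    show "l \<in> topspace (pullback_topology A f T)"
      using R limitin_topspace by (fastforce simp: topspace_pullback_topology)
    fix U assume "openin (pullback_topology A f T) U \<and> l \<in> U"
    then obtain V where V: "openin T V" "U = f -` V \<inter> A" "f l \<in> V"
      by (auto simp: openin_pullback_topology)
    then have "\<forall>\<^sub>F n in net. f (g n) \<in> V" using R limitinD by metis
    moreover have "\<forall>\<^sub>F n in net. g n \<in> A" using R by blast
    ultimately show "\<forall>\<^sub>F n in net. g n \<in> U"
      by (rule eventually_elim2) (simp add: V(2))
  qed
qed

lemma limitin_discrete_topology:
  "limitin (discrete_topology UNIV) g l net \<longleftrightarrow> (\<forall>\<^sub>F n in net. g n = l)"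
proof
  assume "limitin (discrete_topology UNIV) g l net"
  from limitinD[OF this, of "{l}"] show "\<forall>\<^sub>F n in net. g n = l" by simp
next
  assume "\<forall>\<^sub>F n in net. g n = l"
  then show "limitin (discrete_topology UNIV) g l net"
    by (auto simp: limitin_def elim: eventually_mono)
qed

text \<open>
  Integers carry the discrete topology, so convergence of the characteristic functions means that every
  lattice point is eventually decided in the same way.
\<close>
lemma limitin_Newton_topology_iff:
  "limitin Newton_topology S P sequentially \<longleftrightarrow>
    P \<in> New ` calA \<and> (\<forall>\<^sub>F n in sequentially. S n \<in> New ` calA) \<and>
    (\<forall>p. \<forall>\<^sub>F n in sequentially. p \<in> lattice_points (S n) \<longleftrightarrow> p \<in> lattice_points P)"
proof -
  have lat: "lattice_points Q \<in> calA" if "Q \<in> New ` calA" for Q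
    using that by (auto simp: calA_def integrally_closed_def)
  have ev: "\<forall>\<^sub>F n in sequentially. lattice_points (S n) \<in> calA"
    if "\<forall>\<^sub>F n in sequentially. S n \<in> New ` calA"
    using that by (rule eventually_mono) (rule lat)
  have ind: "indicator L p = (indicator L' p :: int) \<longleftrightarrow> (p \<in> L \<longleftrightarrow> p \<in> L')" for L L' p
    by (simp add: indicator_def)
  show ?thesis
    unfolding Newton_topology_def calA_topology_def limitin_pullback_topology limitin_componentwise
      limitin_discrete_topology ind
    using lat ev by (simp only: topspace_product_topology topspace_discrete_topology PiE_UNIV_domain
        extensional_UNIV UNIV_I Pi_UNIV eventually_True) blast
qed

section \<open>The lower boundary of a Newton polyhedron\<close>

context
  fixes M :: "(int \<times> int) set"
  assumes M: "M \<in> calA"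
begin

lemma calA_upward_closed: "upward_closed (New M)"
  using M by (intro upward_closed_New) (simp add: calA_def)

lemma calA_New_iff: "(real_of_int a, real_of_int b) \<in> New M \<longleftrightarrow> (a, b) \<in> M"
proof -
  have "M = lattice_points (New M)" using M by (simp add: calA_def integrally_closed_def)
  then have "(a, b) \<in> M \<longleftrightarrow> (a, b) \<in> lattice_points (New M)" by simp
  then show ?thesis by (simp add: lattice_points_def lattice_emb_def)
qed

lemma calA_upward_closedD: "(a, b) \<in> M \<Longrightarrow> a \<le> a' \<Longrightarrow> b \<le> b' \<Longrightarrow> (a', b') \<in> M"
  using upward_closedD[OF calA_upward_closed, of "real_of_int a" "real_of_int b" "real_of_int a'" "real_of_int b'"]
  by (simp add: calA_New_iff)

lemma calA_nonneg: "(a, b) \<in> M \<Longrightarrow> 0 \<le> a"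
  using M by (auto simp: calA_def)

lemma calA_axis: "(0, b) \<in> M \<Longrightarrow> 0 \<le> b"
  using M by (auto simp: calA_def)

lemma calA_origin: "(0, 0) \<in> M"
  using M by (auto simp: calA_def nat_quadrant_def)

text \<open>
  Since \<open>New M\<close> contains no falling ray, the part of \<open>M\<close> below a falling line is bounded to the right:
  points of it arbitrarily far out would, joined to the origin, give a ray of slope \<open>m / 2\<close> in \<open>New M\<close>. The slope is halved
  to absorb the constant \<open>e\<close>.
\<close>
lemma calA_below_sloped_line:
  assumes "m < 0"
  obtains A where "\<And>a b. (a, b) \<in> M \<Longrightarrow> real_of_int b \<le> m * real_of_int a + e \<Longrightarrow> a \<le> A"
proof -
  have "\<exists>A. \<forall>a b. (a, b) \<in> M \<longrightarrow> real_of_int b \<le> m * real_of_int a + e \<longrightarrow> a \<le> A"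
  proof (rule ccontr)
    assume "\<not> ?thesis"
    then have far: "\<exists>a b. (a, b) \<in> M \<and> real_of_int b \<le> m * real_of_int a + e \<and> A < a" for A
      by (meson not_le)
    have "(t, t * (m / 2)) \<in> New M" if "0 \<le> t" for t
    proof -
      obtain a b where ab: "(a, b) \<in> M" "real_of_int b \<le> m * real_of_int a + e"
          "\<lceil>max t (2 * e / (- m))\<rceil> < a"
        using far by blast
      have a: "t < real_of_int a" "2 * e / (- m) < real_of_int a" using ab(3) by linarith+
      have "e \<le> (- m / 2) * real_of_int a" using a(2) assms by (simp add: field_simps)
      then have b: "real_of_int b \<le> (m / 2) * real_of_int a" using ab(2) by (simp add: field_simps)
      define u where "u = t / real_of_int a"
      have u: "0 \<le> u" "u \<le> 1" "u * real_of_int a = t" using a that by (auto simp: u_def)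
      have "(1 - u) *\<^sub>R (0, 0) + u *\<^sub>R (real_of_int a, real_of_int b) \<in> New M"
        using convex_New lattice_emb_in_New[OF ab(1)] lattice_emb_in_New[OF calA_origin] u
        by (intro convexD) auto
      then have "(t, u * real_of_int b) \<in> New M" using u by simp
      moreover have "u * real_of_int b \<le> t * (m / 2)"
        using mult_left_mono[OF b u(1)] u(3) by (simp add: algebra_simps)
      ultimately show ?thesis using upward_closedD[OF calA_upward_closed] by blast
    qed
    then have "{t *\<^sub>R (1, m / 2) | t. 0 \<le> t} \<subseteq> New M" by auto
    moreover have "\<forall>a b :: real. b < 0 \<and> 0 < a \<longrightarrow> \<not> {t *\<^sub>R (a, b) | t. 0 \<le> t} \<subseteq> New M"
      using M by (simp add: calA_def)
    ultimately show False using assms by (meson half_gt_zero_iff zero_less_one divide_neg_pos zero_less_numeral)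
  qed
  then show thesis using that by blast
qed

text \<open>
  The line of slope \<open>s\<close> through \<open>(c, d)\<close> is a supporting line of \<open>M\<close> from below. The slope is a parameter
  since different slopes occur at the same vertex.
\<close>
definition slope_supports :: "real \<Rightarrow> int \<Rightarrow> int \<Rightarrow> bool" where
  "slope_supports s c d \<longleftrightarrow> (\<forall>a b. (a, b) \<in> M \<longrightarrow>
     real_of_int d + s * (real_of_int a - real_of_int c) \<le> real_of_int b)"

lemma slope_supportsD:
  "slope_supports s c d \<Longrightarrow> (a, b) \<in> M \<Longrightarrow>
     real_of_int d + s * (real_of_int a - real_of_int c) \<le> real_of_int b"
  by (simp add: slope_supports_def)

text \<open>
  The point \<open>(1, b / a)\<close> lies on the segment from the origin to \<open>(a, b)\<close>. As \<open>M\<close> is integrally closed, it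
  contains this point with the height rounded up, and the points of \<open>M\<close> with first coordinate \<open>1\<close> are bounded
  below because \<open>M\<close> is co-artinian.
\<close>
lemma slope_supports_origin: "\<exists>s. slope_supports s 0 0"
proof -
  have "\<exists>B. \<forall>b. (1, b) \<in> M \<longrightarrow> B \<le> b"
  proof (rule ccontr)
    assume "\<not> ?thesis"
    then have "\<exists>b<B. (1, b) \<in> M" for B by (meson not_le)
    then have "(1, b) \<in> M" for b using calA_upward_closedD[of 1 _ 1 b] by (metis less_imp_le order_refl)
    then have "\<not> co_artinian M"
      unfolding co_artinian_def not_not
      by (intro exI[of _ "\<lambda>n. (1, - int n)"]) (auto simp: less_le)
    then show False using M by (simp add: calA_def)
  qed
  then obtain B where B: "\<And>b. (1, b) \<in> M \<Longrightarrow> B \<le> b" by blast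
  have "(real_of_int B - 1) * real_of_int a \<le> real_of_int b" if ab: "(a, b) \<in> M" for a b
  proof (cases "a = 0")
    case True
    then show ?thesis using calA_axis ab by simp
  next
    case False
    then have a: "1 \<le> real_of_int a" using calA_nonneg[OF ab] by linarith
    define q where "q = real_of_int b / real_of_int a"
    have "(1 - 1 / real_of_int a) *\<^sub>R (0, 0) + (1 / real_of_int a) *\<^sub>R (real_of_int a, real_of_int b) \<in> New M"
      using convex_New lattice_emb_in_New[OF ab] lattice_emb_in_New[OF calA_origin] a
      by (intro convexD) auto
    then have "(1, q) \<in> New M" using a by (simp add: q_def)
    then have "(real_of_int 1, real_of_int \<lceil>q\<rceil>) \<in> New M" by (auto elim: upward_closedD[OF calA_upward_closed])
    then have "B \<le> \<lceil>q\<rceil>" using B calA_New_iff by blast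
    then have "real_of_int B - 1 \<le> q" by linarith
    then show ?thesis using a by (simp add: q_def field_simps)
  qed
  then show ?thesis by (auto simp: slope_supports_def)
qed

lemma right_of_supported_point:
  assumes "slope_supports s c d" "(a, b) \<in> M" "b < d"
  shows "c < a"
proof (rule ccontr)
  assume "\<not> c < a"
  then have "(c, b) \<in> M" using assms(2) calA_upward_closedD by (metis not_less order_refl)
  then show False using slope_supportsD[OF assms(1)] assms(3) by fastforce
qed

text \<open>
  Rotate a supporting line at \<open>(c, d)\<close> upwards until it hits \<open>M\<close> to the right of \<open>(c, d)\<close>. The first hit exists because
  only finitely many points to the right lie on or below the line to \<open>(a0, b0)\<close>: there are only finitely many possible first
  coordinates, and the old supporting line bounds the second ones.
\<close>
lemma next_vertex_slope:
  assumes cd: "(c, d) \<in> M" and s: "slope_supports s c d" and low: "(a0, b0) \<in> M" "b0 < d"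
  obtains m a1 b1 where "m < 0" "(a1, b1) \<in> M" "c < a1"
    "real_of_int b1 = real_of_int d + m * (real_of_int a1 - real_of_int c)" "slope_supports m c d"
proof -
  define f :: "int \<times> int \<Rightarrow> real" where
    "f = (\<lambda>(a, b). (real_of_int b - real_of_int d) / (real_of_int a - real_of_int c))"
  define m0 where "m0 = f (a0, b0)"
  have m0: "m0 < 0"
    using right_of_supported_point[OF s low] low by (simp add: m0_def f_def divide_neg_pos)
  define T where "T = {(a, b) \<in> M. c < a \<and> f (a, b) \<le> m0}"
  have T_le: "real_of_int b \<le> m0 * real_of_int a + (real_of_int d - m0 * real_of_int c)"
    if "(a, b) \<in> T" for a b
    using that by (auto simp: T_def f_def field_simps)
  obtain A where A: "\<And>a b. (a, b) \<in> T \<Longrightarrow> a \<le> A"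
    using calA_below_sloped_line[OF m0, of "real_of_int d - m0 * real_of_int c"] T_le
    by (metis (no_types, lifting) T_def mem_Collect_eq case_prodD)
  have "T \<subseteq> {c..A} \<times> {\<lfloor>real_of_int d - \<bar>s\<bar> * (real_of_int A - real_of_int c)\<rfloor>..d}"
  proof (rule subrelI)
    fix a b assume ab: "(a, b) \<in> T"
    then have h: "(a, b) \<in> M" "c < a" "a \<le> A" using A by (auto simp: T_def)
    have "real_of_int b \<le> real_of_int d + m0 * (real_of_int a - real_of_int c)"
      using T_le[OF ab] by (simp add: algebra_simps)
    moreover have "m0 * (real_of_int a - real_of_int c) \<le> 0"
      using m0 h by (intro mult_nonpos_nonneg) auto
    ultimately have 1: "b \<le> d" by linarith
    have "- (s * (real_of_int a - real_of_int c)) \<le> \<bar>s\<bar> * (real_of_int a - real_of_int c)"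
      unfolding minus_mult_left using h by (intro mult_right_mono) auto
    also have "\<dots> \<le> \<bar>s\<bar> * (real_of_int A - real_of_int c)" using h by (intro mult_left_mono) auto
    finally have "real_of_int d - \<bar>s\<bar> * (real_of_int A - real_of_int c) \<le> real_of_int b"
      using slope_supportsD[OF s h(1)] by linarith
    then show "(a, b) \<in> {c..A} \<times> {\<lfloor>real_of_int d - \<bar>s\<bar> * (real_of_int A - real_of_int c)\<rfloor>..d}"
      using 1 h by (simp add: floor_le_iff)
  qed
  then have "finite T" by (rule finite_subset) simp
  moreover have "(a0, b0) \<in> T"
    using low right_of_supported_point[OF s low] by (auto simp: T_def m0_def)
  ultimately obtain p where "is_arg_min f (\<lambda>q. q \<in> T) p"
    using ex_is_arg_min_if_finite[of T f] by blast
  moreover obtain a1 b1 where p: "p = (a1, b1)" by (cases p)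
  ultimately have p1: "(a1, b1) \<in> T" and min: "\<And>q. q \<in> T \<Longrightarrow> f p \<le> f q"
    by (auto simp: is_arg_min_def not_less)
  define m where "m = f p"
  have m: "m \<le> m0" using p1 p by (auto simp: T_def m_def)
  have ab1: "(a1, b1) \<in> M" "c < a1" using p1 by (auto simp: T_def)
  then have b1: "real_of_int b1 = real_of_int d + m * (real_of_int a1 - real_of_int c)"
    by (simp add: m_def p f_def)
  have "slope_supports m c d"
    unfolding slope_supports_def
  proof (intro allI impI)
    fix a b assume ab: "(a, b) \<in> M"
    show "real_of_int d + m * (real_of_int a - real_of_int c) \<le> real_of_int b"
    proof (cases "c < a")
      case True
      have "m \<le> f (a, b)"
      proof (cases "(a, b) \<in> T")
        case False
        then show ?thesis using ab True m by (auto simp: T_def)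
      qed (use min in \<open>auto simp: m_def\<close>)
      then show ?thesis using True by (simp add: f_def field_simps)
    next
      case False
      have "s * (real_of_int a1 - real_of_int c) \<le> m * (real_of_int a1 - real_of_int c)"
        using slope_supportsD[OF s ab1(1)] b1 by simp
      then have "s \<le> m" using ab1(2) by simp
      then have "m * (real_of_int a - real_of_int c) \<le> s * (real_of_int a - real_of_int c)"
        using False by (intro mult_right_mono_neg) auto
      then show ?thesis using slope_supportsD[OF s ab] by linarith
    qed
  qed
  moreover have "m < 0" using m m0 by simp
  ultimately show thesis using that ab1 b1 by blast
qed

text \<open>
  The line of the previous lemma meets \<open>New M\<close> in a face with two points, hence in a facet. Neither kind of
  unbounded facet lies on a line of finite nonzero slope, so the facet is a segment with the primitive
  direction \<open>(k, -1)\<close> and lattice end points.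
\<close>
lemma next_edge:
  assumes cd: "(c, d) \<in> M" and s: "slope_supports s c d" and low: "(a0, b0) \<in> M" "b0 < d"
  obtains k :: nat and c' d' where "1 \<le> k" "c < c'" "(c', d') \<in> M"
    "c' + int k * d' = c + int k * d" "\<And>a b. (a, b) \<in> M \<Longrightarrow> c + int k * d \<le> a + int k * b"
proof -
  obtain m a1 b1 where m: "m < 0" and ab1: "(a1, b1) \<in> M" "c < a1"
      "real_of_int b1 = real_of_int d + m * (real_of_int a1 - real_of_int c)"
    and sm: "slope_supports m c d"
    using next_vertex_slope[OF assms] by blast
  define e where "e = real_of_int d - m * real_of_int c"
  define S where "S = New M \<inter> {p :: real \<times> real. (- m, 1) \<bullet> p = e}"
  have S_iff: "(x, y) \<in> S \<longleftrightarrow> (x, y) \<in> New M \<and> y = m * x + e" for x y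
    by (auto simp: S_def)
  have above: "e \<le> - m * x + 1 * y" if "(x, y) \<in> New M" for x y
    by (rule New_lower_bound[OF _ that]) (use slope_supportsD[OF sm] in \<open>auto simp: e_def algebra_simps\<close>)
  have face: "S face_of New M"
    unfolding S_def using above by (intro face_of_Int_supporting_hyperplane_ge convex_New) auto
  have on_line: "real_of_int b1 = m * real_of_int a1 + e" using ab1(3) by (simp add: e_def algebra_simps)
  have inS: "lattice_emb (c, d) \<in> S" "lattice_emb (a1, b1) \<in> S"
    using lattice_emb_in_New[OF cd] lattice_emb_in_New[OF ab1(1)] on_line
    by (auto simp: lattice_emb_def S_iff e_def)
  have "aff_dim S = 1"
  proof (rule antisym)
    have "aff_dim S \<le> aff_dim {p :: real \<times> real. (- m, 1) \<bullet> p = e}" by (intro aff_dim_subset) (auto simp: S_def)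
    then show "aff_dim S \<le> 1" by (simp add: zero_prod_def)
    have "aff_dim {lattice_emb (c, d), lattice_emb (a1, b1)} = 1"
      using ab1(2) by (simp add: lattice_emb_def)
    then show "1 \<le> aff_dim S" using inS aff_dim_subset[of "{lattice_emb (c, d), lattice_emb (a1, b1)}" S] by simp
  qed
  moreover have "aff_dim (New M) = 2"
    using lattice_emb_in_New[OF cd] by (intro aff_dim_eq_2 calA_upward_closed) auto
  ultimately have facet: "S facet_of New M" using face inS by (auto simp: facet_of_def)
  have "bounded S"
  proof (rule ccontr)
    assume "\<not> bounded S"
    then consider "S = {0} \<times> {0..}" | c d where "S = {c..} \<times> {d}"
      using M facet unfolding calA_def by blast
    then show False
    proof cases
      case 1
      then have "(0, 0) \<in> S" "(0, 1) \<in> S" by auto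
      then show False unfolding S_iff by simp
    next
      case (2 c d)
      then have "(c, d) \<in> S" "(c + 1, d) \<in> S" by auto
      then show False unfolding S_iff using m by (simp add: algebra_simps)
    qed
  qed
  then obtain c1 d1 k m1 :: int where km: "0 < k" "0 < m1"
    and seg: "S = closed_segment (lattice_emb (c1, d1)) (lattice_emb (c1 + m1 * k, d1 - m1))"
    using M facet unfolding calA_def by blast
  have ends: "lattice_emb (c1, d1) \<in> S" "lattice_emb (c1 + m1 * k, d1 - m1) \<in> S"
    unfolding seg by auto
  then have "real_of_int m1 * (m * real_of_int k + 1) = 0"
    by (simp add: lattice_emb_def S_iff algebra_simps)
  then have mk: "m * real_of_int k = - 1" using km by simp
  have lev: "m * x + e = y \<longleftrightarrow> x + real_of_int k * y = real_of_int c + real_of_int k * real_of_int d" for x y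
  proof -
    have "m * x + e = y \<longleftrightarrow> real_of_int k * (m * x + e) = real_of_int k * y" using km by simp
    also have "real_of_int k * (m * x + e) = (m * real_of_int k) * x + real_of_int k * real_of_int d
        - (m * real_of_int k) * real_of_int c"
      by (simp add: e_def algebra_simps)
    finally show ?thesis unfolding mk by auto
  qed
  show thesis
  proof (rule that)
    show "1 \<le> nat k" using km by simp
    show "(c1 + m1 * k, d1 - m1) \<in> M"
      using ends(2) unfolding lattice_emb_def S_iff fst_conv snd_conv by (simp only: calA_New_iff)
    obtain t where t: "0 \<le> t" "t \<le> 1"
      "lattice_emb (a1, b1) = (1 - t) *\<^sub>R lattice_emb (c1, d1) + t *\<^sub>R lattice_emb (c1 + m1 * k, d1 - m1)"
      using inS(2) unfolding seg closed_segment_def by blast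
    then have "real_of_int a1 = real_of_int c1 + t * real_of_int (m1 * k)"
      by (simp add: lattice_emb_def algebra_simps)
    also have "\<dots> \<le> real_of_int c1 + 1 * real_of_int (m1 * k)"
      using t km by (intro add_left_mono mult_right_mono) auto
    finally have "a1 \<le> c1 + m1 * k" by linarith
    then show "c < c1 + m1 * k" using ab1(2) by linarith
    have "real_of_int (c1 + m1 * k) + real_of_int k * real_of_int (d1 - m1)
        = real_of_int c + real_of_int k * real_of_int d"
      using ends(2) unfolding lattice_emb_def S_iff fst_conv snd_conv lev[symmetric] by simp
    then have "c1 + m1 * k + k * (d1 - m1) = c + k * d"
      by (metis of_int_add of_int_eq_iff of_int_mult)
    then show "c1 + m1 * k + int (nat k) * (d1 - m1) = c + int (nat k) * d" using km by simp
    show "c + int (nat k) * d \<le> a + int (nat k) * b" if ab: "(a, b) \<in> M" for a b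
    proof -
      have "real_of_int k * (real_of_int d + m * (real_of_int a - real_of_int c)) \<le> real_of_int k * real_of_int b"
        using slope_supportsD[OF sm ab] km by (intro mult_left_mono) auto
      also have "real_of_int k * (real_of_int d + m * (real_of_int a - real_of_int c)) =
          real_of_int k * real_of_int d + (m * real_of_int k) * (real_of_int a - real_of_int c)"
        by (simp add: algebra_simps)
      finally have "real_of_int (c + k * d) \<le> real_of_int (a + k * b)" unfolding mk by simp
      then show ?thesis using km by (simp only: of_int_le_iff) simp
    qed
  qed
qed

text \<open>
  The first edge, which starts at the origin, has slope \<open>-1/k \<ge> -1\<close>. This is what makes the support value
  at \<open>k = 1\<close> vanish.
\<close>
lemma calA_sum_nonneg:
  assumes "(a, b) \<in> M"
  shows "0 \<le> a + b"
proof (cases "0 \<le> b")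
  case True
  then show ?thesis using calA_nonneg[OF assms] by simp
next
  case False
  obtain s where "slope_supports s 0 0" using slope_supports_origin by blast
  then obtain k :: nat where k: "1 \<le> k" "0 \<le> a + int k * b"
    using next_edge[OF calA_origin _ assms, of s] False assms by (metis add_0 mult_zero_right not_le)
  have "int k * b \<le> 1 * b" using False k by (intro mult_right_mono_neg) auto
  then show ?thesis using k by simp
qed

text \<open>
  The inequalities in the directions \<open>(1, k)\<close> suffice for membership. They are stated without minima: each form takes
  somewhere on \<open>M\<close> a value that is at most the one at \<open>(x, y)\<close>.
\<close>
lemma calA_mem_if_above_support:
  assumes H: "\<And>k. \<exists>(a, b) \<in> M. a + int k * b \<le> x + int k * y"
  shows "(x, y) \<in> M"
proof -
  have x: "0 \<le> x" using H[of 0] calA_nonneg by fastforce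
  \<comment> \<open>The supported lattice point with the largest first coordinate up to \<open>x\<close>: the edge that
    starts there, if there is one, must end beyond \<open>x\<close>, since its right end is supported too.\<close>
  define V where "V = {c \<in> {0..x}. \<exists>d s. (c, d) \<in> M \<and> slope_supports s c d}"
  have "V \<subseteq> {0..x}" by (auto simp: V_def)
  then have V: "finite V" "0 \<in> V"
    using x calA_origin slope_supports_origin by (auto simp: V_def intro: finite_subset)
  then have "Max V \<in> V" by (intro Max_in) auto
  then obtain c d s where c: "c = Max V" "0 \<le> c" "c \<le> x" "(c, d) \<in> M" "slope_supports s c d"
    by (auto simp: V_def)
  show ?thesis
  proof (cases "\<exists>(a, b) \<in> M. b < d")
    case True
    then obtain a0 b0 where "(a0, b0) \<in> M" "b0 < d" by blast
    then obtain k :: nat and c' d' where k: "1 \<le> k" and c': "c < c'" "(c', d') \<in> M"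
      and eq: "c' + int k * d' = c + int k * d"
      and ge: "\<And>a b. (a, b) \<in> M \<Longrightarrow> c + int k * d \<le> a + int k * b"
      using next_edge[OF c(4,5)] by metis
    have "slope_supports (- 1 / real k) c' d'"
      unfolding slope_supports_def
    proof (intro allI impI)
      fix a b assume "(a, b) \<in> M"
      then have "real_of_int (c' + int k * d') \<le> real_of_int (a + int k * b)"
        using ge eq by (simp only: of_int_le_iff)
      then show "real_of_int d' + (- 1 / real k) * (real_of_int a - real_of_int c') \<le> real_of_int b"
        using k by (simp add: field_simps)
    qed
    then have "x < c'"
      using Max_ge[OF V(1), of c'] c c' by (force simp: V_def)
    have "c + int k * d \<le> x + int k * y" using H[of k] ge by fastforce
    then have le: "real_of_int c + real k * real_of_int d \<le> real_of_int x + real k * real_of_int y"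
      by (metis of_int_add of_int_le_iff of_int_mult of_int_of_nat_eq)
    have eq': "real k * (real_of_int d' - real_of_int d) = real_of_int c - real_of_int c'"
    proof -
      have "int k * (d' - d) = c - c'" using eq by (simp add: algebra_simps)
      then show ?thesis by (metis of_int_diff of_int_mult of_int_of_nat_eq)
    qed
    define t where "t = real_of_int (x - c) / real_of_int (c' - c)"
    have t: "0 \<le> t" "t \<le> 1" "t * (real_of_int c' - real_of_int c) = real_of_int x - real_of_int c"
      using c c' \<open>x < c'\<close> by (auto simp: t_def)
    have "(1 - t) *\<^sub>R (real_of_int c, real_of_int d) + t *\<^sub>R (real_of_int c', real_of_int d') \<in> New M"
      using convex_New lattice_emb_in_New[OF c(4)] lattice_emb_in_New[OF c'(2)] t
      by (intro convexD) auto
    moreover have "(1 - t) *\<^sub>R (real_of_int c, real_of_int d) + t *\<^sub>R (real_of_int c', real_of_int d')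
        = (real_of_int x, real_of_int d + t * (real_of_int d' - real_of_int d))"
      using t(3) by (simp add: algebra_simps)
    moreover have "real_of_int d + t * (real_of_int d' - real_of_int d) \<le> real_of_int y"
    proof -
      have "real k * (real_of_int d + t * (real_of_int d' - real_of_int d))
          = real k * real_of_int d + t * (real k * (real_of_int d' - real_of_int d))"
        by (simp add: algebra_simps)
      also have "\<dots> = real k * real_of_int d - t * (real_of_int c' - real_of_int c)"
        unfolding eq' by (simp add: algebra_simps)
      also have "\<dots> \<le> real k * real_of_int y" unfolding t(3) using le by simp
      finally show ?thesis using k by simp
    qed
    ultimately have "(real_of_int x, real_of_int y) \<in> New M"
      using upward_closedD[OF calA_upward_closed] by (metis order_refl)
    then show ?thesis by (simp add: calA_New_iff)
  next
    case False
    \<comment> \<open>All of \<open>M\<close> has height at least \<open>d\<close>. A point with \<open>y < d\<close> would violate the inequality of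
      any direction \<open>(1, k)\<close> with \<open>k > x\<close>.\<close>
    define k where "k = nat (x + 1)"
    obtain a b where ab: "(a, b) \<in> M" "a + int k * b \<le> x + int k * y" using H[of k] by blast
    have "int k * d \<le> int k * b" using False ab by (intro mult_left_mono) auto
    then have "int k * d < int k * (y + 1)"
      using ab calA_nonneg[OF ab(1)] x by (simp add: k_def algebra_simps)
    then have "d \<le> y" using x by (simp add: k_def)
    then show ?thesis using calA_upward_closedD[OF c(4)] c(3) by blast
  qed
qed

text \<open>
  Negative values of \<open>x + k y\<close> occur only below the line of slope \<open>-1/k\<close> through the origin. There the first
  coordinate is bounded, and with it the second one by a supporting line at the origin.
\<close>
lemma calA_minimum_exists:
  "\<exists>(a, b) \<in> M. \<forall>(a', b') \<in> M. a + int k * b \<le> a' + int k * b'"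
proof (cases "k = 0")
  case True
  then show ?thesis using calA_origin calA_nonneg by fastforce
next
  case False
  obtain s where s: "slope_supports s 0 0" using slope_supports_origin by blast
  obtain A where A: "\<And>a b. (a, b) \<in> M \<Longrightarrow> real_of_int b \<le> (- 1 / real k) * real_of_int a + 0 \<Longrightarrow> a \<le> A"
    using calA_below_sloped_line[of "- 1 / real k" 0] False
    by (metis divide_neg_pos neg_less_0_iff_less of_nat_0_less_iff zero_less_one
        bot_nat_0.not_eq_extremum)
  define L where "L = - (int k * \<lceil>\<bar>s\<bar> * real_of_int A\<rceil>)"
  have "min 0 L \<le> a + int k * b" if ab: "(a, b) \<in> M" for a b
  proof (cases "0 \<le> a + int k * b")
    case False
    then have "real_of_int (a + int k * b) \<le> 0" by linarith
    then have "a \<le> A" using \<open>k \<noteq> 0\<close> ab by (intro A[of a b]) (auto simp: field_simps)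
    have a: "0 \<le> a" using calA_nonneg[OF ab] .
    have "- (s * real_of_int a) \<le> \<bar>s\<bar> * real_of_int a"
      unfolding minus_mult_left using a by (intro mult_right_mono) auto
    also have "\<dots> \<le> \<bar>s\<bar> * real_of_int A" using \<open>a \<le> A\<close> by (intro mult_left_mono) auto
    finally have "- \<lceil>\<bar>s\<bar> * real_of_int A\<rceil> \<le> b"
      using slope_supportsD[OF s ab] by simp linarith
    then have "int k * (- \<lceil>\<bar>s\<bar> * real_of_int A\<rceil>) \<le> int k * b" by (intro mult_left_mono) auto
    then show ?thesis using a by (simp add: L_def)
  qed simp
  note L = this
  obtain p where p: "p \<in> M"
      "\<And>q. q \<in> M \<Longrightarrow> nat (fst p + int k * snd p - min 0 L) \<le> nat (fst q + int k * snd q - min 0 L)"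
    using ex_has_least_nat[of "\<lambda>p. p \<in> M" "(0, 0)" "\<lambda>p. nat (fst p + int k * snd p - min 0 L)"]
      calA_origin by blast
  have "fst p + int k * snd p \<le> a + int k * b" if "(a, b) \<in> M" for a b
    using p(2)[OF that] L[OF that] L[of "fst p" "snd p"] p(1) by simp
  then show ?thesis using p(1) by (intro bexI[of _ p]) auto
qed

text \<open>
  The support values of \<open>M\<close> form a concave sequence that starts with \<open>0, 0\<close>. Its negated second differences
  are the multiplicities, and summing them twice gives the sequence back.
\<close>
lemma calA_eq_lattice_points_region:
  "\<exists>a. M = lattice_points (region a)"
proof -
  have "\<exists>h. (\<exists>(a, b) \<in> M. a + int k * b = h) \<and> (\<forall>(a, b) \<in> M. h \<le> a + int k * b)" for k
    using calA_minimum_exists[of k] by fastforce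
  then have "\<forall>k. \<exists>h. (\<exists>(a, b) \<in> M. a + int k * b = h) \<and> (\<forall>(a, b) \<in> M. h \<le> a + int k * b)"
    by blast
  from choice[OF this] obtain h where
    h: "\<forall>k. (\<exists>(a, b) \<in> M. a + int k * b = h k) \<and> (\<forall>(a, b) \<in> M. h k \<le> a + int k * b)" ..
  have attained: "\<exists>(a, b) \<in> M. a + int k * b = h k" for k using h by blast
  have lower: "h k \<le> a + int k * b" if "(a, b) \<in> M" for k a b using h that by blast
  have h0: "h 0 = 0"
  proof (rule antisym)
    show "h 0 \<le> 0" using lower[OF calA_origin, of 0] by simp
    obtain a b where "(a, b) \<in> M" "a + int 0 * b = h 0" using attained by blast
    then show "0 \<le> h 0" using calA_nonneg[of a b] by simp
  qed
  have h1: "h (Suc 0) = 0"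
  proof (rule antisym)
    show "h (Suc 0) \<le> 0" using lower[OF calA_origin, of "Suc 0"] by simp
    obtain a b where "(a, b) \<in> M" "a + int (Suc 0) * b = h (Suc 0)" using attained by blast
    then show "0 \<le> h (Suc 0)" using calA_sum_nonneg[of a b] by simp
  qed
  have concave: "h (Suc (Suc k)) + h k \<le> 2 * h (Suc k)" for k
  proof -
    obtain a b where ab: "(a, b) \<in> M" "a + int (Suc k) * b = h (Suc k)" using attained by blast
    then show ?thesis using lower[OF ab(1), of k] lower[OF ab(1), of "Suc (Suc k)"]
      by (simp add: algebra_simps)
  qed
  define a where "a k = nat (2 * h k - h (Suc k) - h (k - 1))" for k
  have "support_value a k = h k \<and> vertex_y a (Suc k) = h (Suc k) - h k" for k
  proof (induction k)
    case 0
    then show ?case by (simp add: h0 h1)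
  next
    case (Suc k)
    have "int (a (Suc k)) = 2 * h (Suc k) - h (Suc (Suc k)) - h k"
      using concave[of k] by (simp add: a_def)
    then show ?case using Suc by (simp add: support_value_Suc vertex_y_Suc)
  qed
  then have "(x, y) \<in> lattice_points (region a) \<longleftrightarrow> (\<forall>k. h k \<le> x + int k * y)" for x y
    by (simp add: lattice_points_region_iff)
  moreover have "(x, y) \<in> M \<longleftrightarrow> (\<forall>k. h k \<le> x + int k * y)" for x y
  proof
    assume le: "\<forall>k. h k \<le> x + int k * y"
    show "(x, y) \<in> M"
    proof (rule calA_mem_if_above_support)
      fix k
      obtain a b where "(a, b) \<in> M" "a + int k * b = h k" using attained by blast
      then show "\<exists>(a, b) \<in> M. a + int k * b \<le> x + int k * y"
        using le[rule_format, of k] by (intro bexI[of _ "(a, b)"]) auto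
    qed
  qed (use lower in blast)
  ultimately have "M = lattice_points (region a)" by auto
  then show ?thesis by blast
qed

end

section \<open>Decomposition into the polyhedra of the sets \<open>F j\<close>\<close>

theorem corollary23:
  fixes M :: "(int \<times> int) set" and P :: "(real \<times> real) set"
  assumes "M \<in> calA" and "P = New M"
  shows "(\<forall>j\<ge>1. New (F j) = real_quadrant + closed_segment (0, 0) (real j, - 1)) \<and>
    (\<exists>!a. a \<in> {1..} \<rightarrow>\<^sub>E (UNIV :: nat set) \<and>
          converges_to_poly (\<lambda>j. poly_mult (a j) (New (F j))) P)"
proof (intro conjI allI impI New_F)
  have lat: "lattice_points P = M"
    using assms by (simp add: calA_def integrally_closed_def)
  have P: "P \<in> New ` calA" using assms by blast
  have conv: "converges_to_poly (\<lambda>j. poly_mult (a j) (New (F j))) P \<longleftrightarrow>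
      lattice_points (region a) = M" for a
  proof -
    have truncation: "region (truncation n a) \<in> New ` calA" for n
    proof -
      have "New (lattice_points (region (truncation n a))) = region (truncation n a)"
        by (rule New_lattice_points_region[OF truncation_eq_0])
      moreover have "lattice_points (region (truncation n a)) \<in> calA"
        by (rule lattice_points_region_in_calA[OF truncation_eq_0])
      ultimately show ?thesis by (metis imageI)
    qed
    then have "converges_to_poly (\<lambda>j. poly_mult (a j) (New (F j))) P \<longleftrightarrow>
        (\<forall>p. \<forall>\<^sub>F n in sequentially. p \<in> lattice_points (region (truncation n a)) \<longleftrightarrow> p \<in> M)"
      unfolding converges_to_poly_def poly_sum_eq_region limitin_Newton_topology_iff lat
      using P by simp
    also have "\<dots> \<longleftrightarrow> (\<forall>p. p \<in> lattice_points (region a) \<longleftrightarrow> p \<in> M)"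
    proof (rule all_cong1, rule iffI)
      fix p
      assume "\<forall>\<^sub>F n in sequentially. p \<in> lattice_points (region (truncation n a)) \<longleftrightarrow> p \<in> M"
      from eventually_conj[OF this eventually_in_truncated_region[of p a]]
      have "\<forall>\<^sub>F n in sequentially. p \<in> lattice_points (region a) \<longleftrightarrow> p \<in> M"
        by (rule eventually_mono) blast
      then show "p \<in> lattice_points (region a) \<longleftrightarrow> p \<in> M" by simp
    next
      fix p
      assume "p \<in> lattice_points (region a) \<longleftrightarrow> p \<in> M"
      then show "\<forall>\<^sub>F n in sequentially. p \<in> lattice_points (region (truncation n a)) \<longleftrightarrow> p \<in> M"
        using eventually_in_truncated_region[of p a] by (simp only:)
    qed
    finally show ?thesis by (simp only: set_eq_iff)
  qed
  obtain a where a: "M = lattice_points (region a)"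
    using calA_eq_lattice_points_region[OF assms(1)] ..
  show "\<exists>!a. a \<in> {1..} \<rightarrow>\<^sub>E (UNIV :: nat set) \<and>
      converges_to_poly (\<lambda>j. poly_mult (a j) (New (F j))) P"
    unfolding conv
  proof (rule ex1I[of _ "restrict a {1..}"])
    have "region (restrict a {1..}) = region a"
      by (simp add: region_def support_value_def vertex_x_def vertex_y_def)
    then show "restrict a {1..} \<in> {1..} \<rightarrow>\<^sub>E UNIV \<and> lattice_points (region (restrict a {1..})) = M"
      using a by simp
    fix b assume b: "b \<in> {1..} \<rightarrow>\<^sub>E UNIV \<and> lattice_points (region b) = M"
    show "b = restrict a {1..}"
    proof
      fix j
      show "b j = restrict a {1..} j"
      proof (cases "1 \<le> j")
        case True
        then show ?thesis using multiplicities_unique[of b a j] b a by simp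
      next
        case False
        then show ?thesis using PiE_arb[of b "{1..}" "\<lambda>_. UNIV" j] b by simp
      qed
    qed
  qed
qed

end
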